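(* There exist universal constants $c,c_\epsilon>0$ and $d_0\in\mathbb N$ such that, whenever $d\ge d_0$, $R>0$, $0<\mu\le\beta$, and $0<\epsilon\le c_\epsilon\beta R^2$, one has $$N_\epsilon(d,R,\mu,\beta)\ge c\,d\,\min\left\{\sqrt Q,\ \sqrt\kappa,\ D_d\right\},$$ where $Q=\beta R^2/\epsilon$, $\kappa=\beta/\mu$, and $D_d=\left(d/\log(ed)\right)^{1/3}$.
   Context: $B_2^d(r)$ is the closed Euclidean ball of radius $r$ centred at $0$ in $\mathbb R^d$; $X:=B_2^d(R)$. Class $\mathcal F_{\mu,\beta}(d,R)$: all continuously differentiable $f:\mathbb R^d\to\mathbb R$ such that for all $x,y\in\mathbb R^d$, $f(y)\ge f(x)+\langle\nabla f(x),y-x\rangle+\frac\mu2\|y-x\|_2^2$ and $\|\nabla f(x)-\nabla f(y)\|_2\le\beta\|x-y\|_2$, and whose unique minimizer $x_f^\star$ lies in $B_2^d(R/2)$. Write $f^\star=f(x_f^\star)$. A deterministic adaptive algorithm with budget $T$ (a $T$-call algorithm) consists of Borel maps $Q_t:(X\times\mathbb R)^{t-1}\to X$, $t=1,\dots,T$, and a Borel terminal map $Q_{\mathrm{out}}:(X\times\mathbb R)^T\to X$. On a fixed objective $f$ it generates recursively $x_t=Q_t((x_1,f(x_1)),\dots,(x_{t-1},f(x_{t-1})))$ and outputs $\widehat x_f=Q_{\mathrm{out}}((x_1,f(x_1)),\dots,(x_T,f(x_T)))$. Minimax exact-value complexity: $N_\epsilon(d,R,\mu,\beta)$ is the infimum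 of all $T\in\mathbb N_0$ for which there exists a deterministic adaptive $T$-call algorithm with $\sup_{f\in\mathcal F_{\mu,\beta}(d,R)}[f(\widehat x_f)-f^\star]\le\epsilon$ (with $\inf\varnothing=+\infty$). *)

theory Defs
  imports "HOL-Analysis.Analysis"
begin

text \<open>
  The constants of the theorem are uniform in the dimension, so \<open>d\<close> has to be a natural number
  rather than a type. A vector of \<open>\<real>\<^sup>d\<close> is a function extensional on \<open>{..<d}\<close>. All such functions
  agree outside \<open>{..<d}\<close>, so the product topology of \<^typ>\<open>nat \<Rightarrow> real\<close> induces on this
  set the Euclidean topology. Objectives have type \<^typ>\<open>(nat \<Rightarrow> real) \<Rightarrow> real\<close>, and only their
  values on \<open>\<real>\<^sup>d\<close> matter.
\<close>

definition Rd :: "nat \<Rightarrow> (nat \<Rightarrow> real) set" where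
  "Rd d = PiE {..<d} (\<lambda>_. UNIV)"

definition dot :: "nat \<Rightarrow> (nat \<Rightarrow> real) \<Rightarrow> (nat \<Rightarrow> real) \<Rightarrow> real" where
  "dot d x y = (\<Sum>i<d. x i * y i)"

definition vdiff :: "nat \<Rightarrow> (nat \<Rightarrow> real) \<Rightarrow> (nat \<Rightarrow> real) \<Rightarrow> (nat \<Rightarrow> real)" where
  "vdiff d x y = (\<lambda>i\<in>{..<d}. x i - y i)"

abbreviation nrm :: "nat \<Rightarrow> (nat \<Rightarrow> real) \<Rightarrow> real" where
  "nrm d x \<equiv> L2_set x {..<d}"

definition B2 :: "nat \<Rightarrow> real \<Rightarrow> (nat \<Rightarrow> real) set" where
  "B2 d r = {x \<in> Rd d. nrm d x \<le> r}"

text \<open>Frechet differentiability at \<open>x\<close> with gradient \<open>g\<close>.\<close>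

definition has_gradient ::
  "nat \<Rightarrow> ((nat \<Rightarrow> real) \<Rightarrow> real) \<Rightarrow> (nat \<Rightarrow> real) \<Rightarrow> (nat \<Rightarrow> real) \<Rightarrow> bool" where
  "has_gradient d f g x \<longleftrightarrow> g \<in> Rd d \<and>
     ((\<lambda>y. (f y - f x - dot d g (vdiff d y x)) / nrm d (vdiff d y x)) \<longlongrightarrow> 0) (at x within Rd d)"

definition is_minimizer :: "nat \<Rightarrow> ((nat \<Rightarrow> real) \<Rightarrow> real) \<Rightarrow> (nat \<Rightarrow> real) \<Rightarrow> bool" where
  "is_minimizer d f x \<longleftrightarrow> x \<in> Rd d \<and> (\<forall>y\<in>Rd d. f x \<le> f y)"

definition minimizer :: "nat \<Rightarrow> ((nat \<Rightarrow> real) \<Rightarrow> real) \<Rightarrow> (nat \<Rightarrow> real)" where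
  "minimizer d f = (THE x. is_minimizer d f x)"

text \<open>In the next definition \<open>G\<close> is the gradient field of \<open>f\<close>, which is uniquely determined on
  \<open>\<real>\<^sup>d\<close>.\<close>

definition Fclass :: "nat \<Rightarrow> real \<Rightarrow> real \<Rightarrow> real \<Rightarrow> ((nat \<Rightarrow> real) \<Rightarrow> real) set" where
  "Fclass d R \<mu> \<beta> = {f.
     (\<exists>G. (\<forall>x\<in>Rd d. has_gradient d f (G x) x) \<and> continuous_on (Rd d) G \<and>
        (\<forall>x\<in>Rd d. \<forall>y\<in>Rd d.
           f y \<ge> f x + dot d (G x) (vdiff d y x) + \<mu> / 2 * (nrm d (vdiff d y x))\<^sup>2 \<and>
           nrm d (vdiff d (G x) (G y)) \<le> \<beta> * nrm d (vdiff d x y))) \<and>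
     (\<exists>!x. is_minimizer d f x) \<and> minimizer d f \<in> B2 d (R / 2)}"

type_synonym history = "nat \<Rightarrow> (nat \<Rightarrow> real) \<times> real"

text \<open>
  The Borel \<open>\<sigma>\<close>-algebras of \<open>X = B2 d R\<close> and of \<open>(X \<times> \<real>)\<^sup>t\<close>; all spaces are second countable, so
  the Borel \<open>\<sigma>\<close>-algebra of a finite product is the product \<open>\<sigma>\<close>-algebra. Queries are numbered from
  0: the query with index \<open>t < T\<close> depends on a history of length \<open>t\<close>, a function
  extensional on \<open>{..<t}\<close>.
\<close>

definition Xspace :: "nat \<Rightarrow> real \<Rightarrow> (nat \<Rightarrow> real) measure" where
  "Xspace d R = restrict_space (PiM {..<d} (\<lambda>_. borel)) (B2 d R)"

definition Hspace :: "nat \<Rightarrow> real \<Rightarrow> nat \<Rightarrow> history measure" where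
  "Hspace d R t = PiM {..<t} (\<lambda>_. Xspace d R \<Otimes>\<^sub>M borel)"

definition algorithm ::
  "nat \<Rightarrow> real \<Rightarrow> nat \<Rightarrow> (nat \<Rightarrow> history \<Rightarrow> nat \<Rightarrow> real) \<Rightarrow> (history \<Rightarrow> nat \<Rightarrow> real) \<Rightarrow> bool" where
  "algorithm d R T Q Qout \<longleftrightarrow>
     (\<forall>t<T. Q t \<in> Hspace d R t \<rightarrow>\<^sub>M Xspace d R) \<and> Qout \<in> Hspace d R T \<rightarrow>\<^sub>M Xspace d R"

primrec run :: "(nat \<Rightarrow> history \<Rightarrow> nat \<Rightarrow> real) \<Rightarrow> ((nat \<Rightarrow> real) \<Rightarrow> real) \<Rightarrow> nat \<Rightarrow> history" where
  "run Q f 0 = (\<lambda>_. undefined)"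
| "run Q f (Suc t) = (let x = Q t (run Q f t) in (run Q f t)(t := (x, f x)))"

definition final_point ::
  "nat \<Rightarrow> (nat \<Rightarrow> history \<Rightarrow> nat \<Rightarrow> real) \<Rightarrow> (history \<Rightarrow> nat \<Rightarrow> real) \<Rightarrow>
   ((nat \<Rightarrow> real) \<Rightarrow> real) \<Rightarrow> (nat \<Rightarrow> real)" where
  "final_point T Q Qout f = Qout (run Q f T)"

text \<open>In \<^typ>\<open>enat\<close> the infimum of the empty set is \<open>\<infinity>\<close>.\<close>

definition Ncomp :: "real \<Rightarrow> nat \<Rightarrow> real \<Rightarrow> real \<Rightarrow> real \<Rightarrow> enat" where
  "Ncomp \<epsilon> d R \<mu> \<beta> = (INF T\<in>{T. \<exists>Q Qout. algorithm d R T Q Qout \<and>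
     (SUP f\<in>Fclass d R \<mu> \<beta>. ereal (f (final_point T Q Qout f) - f (minimizer d f))) \<le> ereal \<epsilon>}. enat T)"

end

(*
Fix k orthonormal directions v_0, ..., v_{k-1} and let f(x) be a multiple of a smoothed version of
max_j (<v_j, x> - j*delta) plus a small quadratic. The smoothing is local: an entry that stays below
the maximum by more than the smoothing radius does not influence the value. The directions are chosen
by a resisting oracle in k phases of about d/4 queries. During phase j the answers are those of the
function with v_j = v_{j+1} = ... = 0. After phase j a unit vector v_j is chosen orthogonal to the
queries of that phase, and with inner product of size at most delta/2, that is of order
sqrt(log d / d), with all earlier queries, so by locality no answer changes. This needs
k^(-3/2) >> sqrt(log d / d), which is where the cube root in D_d comes from. Any point whose inner
product with v_{k-1} vanishes is then suboptimal by order beta R^2 / k^2. When the minimum in the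
bound is below an absolute constant, the function beta/2 |x - a|^2 with a orthogonal to all queries
shows that about d queries are needed.
*)

theory Submission
  imports Defs
begin

section \<open>Linear algebra and near-orthogonal vectors\<close>

lemma nrm_sq: "(nrm d x)\<^sup>2 = dot d x x"
  by (simp add: L2_set_def dot_def sum_nonneg power2_eq_square)

lemma dot_self_nonneg: "0 \<le> dot d x x"
  by (simp add: dot_def sum_nonneg)

lemma dot_commute: "dot d x y = dot d y x"
  by (simp add: dot_def mult.commute)

lemma dot_vdiff_right: "dot d g (vdiff d y x) = dot d g y - dot d g x"
  by (simp add: dot_def vdiff_def sum_subtractf algebra_simps)

lemma dot_vdiff_left: "dot d (vdiff d y x) g = dot d y g - dot d x g"
  by (simp add: dot_def vdiff_def sum_subtractf algebra_simps)

lemma dot_scale_left: "dot d (\<lambda>i. c * x i) y = c * dot d x y"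
  by (simp add: dot_def sum_distrib_left algebra_simps)

lemma dot_add_left: "dot d (\<lambda>i. x i + y i) z = dot d x z + dot d y z"
  by (simp add: dot_def sum.distrib algebra_simps)

lemma dot_sum_left: "dot d (\<lambda>i. \<Sum>j\<in>J. c j * W j i) y = (\<Sum>j\<in>J. c j * dot d (W j) y)"
proof -
  have "dot d (\<lambda>i. \<Sum>j\<in>J. c j * W j i) y = (\<Sum>i<d. \<Sum>j\<in>J. c j * (W j i * y i))"
    by (simp add: dot_def sum_distrib_right mult.assoc)
  also have "\<dots> = (\<Sum>j\<in>J. \<Sum>i<d. c j * (W j i * y i))"
    by (rule sum.swap)
  finally show ?thesis
    by (simp add: dot_def sum_distrib_left)
qed

lemma dot_restrict_left [simp]: "dot d (restrict x {..<d}) y = dot d x y"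
  by (simp add: dot_def)

lemma dot_restrict_right [simp]: "dot d y (restrict x {..<d}) = dot d y x"
  by (simp add: dot_def)

lemma dot_le_nrm: "\<bar>dot d x y\<bar> \<le> nrm d x * nrm d y"
proof -
  have "\<bar>dot d x y\<bar> \<le> (\<Sum>i<d. \<bar>x i\<bar> * \<bar>y i\<bar>)"
    unfolding dot_def by (rule order_trans[OF sum_abs]) (simp add: abs_mult)
  also have "\<dots> \<le> nrm d x * nrm d y"
    by (rule L2_set_mult_ineq)
  finally show ?thesis .
qed

lemma nrm_le_iff: "0 \<le> r \<Longrightarrow> nrm d x \<le> r \<longleftrightarrow> dot d x x \<le> r\<^sup>2"
  by (metis L2_set_nonneg abs_le_square_iff abs_of_nonneg nrm_sq)

section \<open>Orthonormal families and Bessel's inequality\<close>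

definition orthonormal :: "nat \<Rightarrow> nat \<Rightarrow> (nat \<Rightarrow> nat \<Rightarrow> real) \<Rightarrow> bool" where
  "orthonormal d m W \<longleftrightarrow> (\<forall>i<m. \<forall>j<m. dot d (W i) (W j) = (if i = j then 1 else 0))"

lemma dot_combination:
  assumes "orthonormal d m W" "j < m"
  shows "dot d (\<lambda>i. \<Sum>l<m. c l * W l i) (W j) = c j"
proof -
  have "dot d (\<lambda>i. \<Sum>l<m. c l * W l i) (W j) = (\<Sum>l<m. if l = j then c l else 0)"
    unfolding dot_sum_left using assms by (intro sum.cong) (auto simp: orthonormal_def)
  also have "\<dots> = c j"
    using assms(2) by simp
  finally show ?thesis .
qed

lemma dot_combination_self:
  assumes "orthonormal d m W"
  shows "dot d (\<lambda>i. \<Sum>l<m. c l * W l i) (\<lambda>i. \<Sum>l<m. c l * W l i) = (\<Sum>l<m. (c l)\<^sup>2)"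
  unfolding dot_sum_left
  using dot_combination[OF assms]
  by (simp add: dot_commute[of d _ "\<lambda>i. \<Sum>l<m. c l * W l i"] power2_eq_square)

lemma bessel:
  assumes "orthonormal d m W"
  shows "(\<Sum>j<m. (dot d (W j) z)\<^sup>2) \<le> dot d z z"
proof -
  let ?p = "\<lambda>i. \<Sum>l<m. dot d (W l) z * W l i"
  have pz: "dot d ?p z = (\<Sum>j<m. (dot d (W j) z)\<^sup>2)"
    unfolding dot_sum_left by (simp add: power2_eq_square)
  have "0 \<le> dot d (vdiff d z ?p) (vdiff d z ?p)"
    by (rule dot_self_nonneg)
  also have "\<dots> = dot d z z - 2 * dot d ?p z + dot d ?p ?p"
    by (simp add: dot_vdiff_left dot_vdiff_right dot_commute[of d z ?p])
  finally show ?thesis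
    unfolding pz dot_combination_self[OF assms] by simp
qed

text \<open>Gaussian elimination, by induction on the number of equations: an equation with a
  nonzero coefficient eliminates one unknown.\<close>

lemma underdetermined_system:
  fixes a :: "nat \<Rightarrow> nat \<Rightarrow> real"
  assumes "finite I" "n < card I"
  shows "\<exists>x. (\<exists>i\<in>I. x i \<noteq> 0) \<and> (\<forall>j<n. (\<Sum>i\<in>I. a j i * x i) = 0)"
  using assms
proof (induction n arbitrary: I a)
  case 0
  then have "I \<noteq> {}" by auto
  then show ?case by (intro exI[of _ "\<lambda>_. 1"]) auto
next
  case (Suc n)
  show ?case
  proof (cases "\<forall>i\<in>I. a n i = 0")
    case True
    from Suc.IH[of I a] Suc.prems obtain x
      where x: "\<exists>i\<in>I. x i \<noteq> 0" "\<forall>j<n. (\<Sum>i\<in>I. a j i * x i) = 0"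
      by auto
    have "\<forall>j<Suc n. (\<Sum>i\<in>I. a j i * x i) = 0"
      using x(2) True by (auto simp: less_Suc_eq)
    then show ?thesis using x(1) by blast
  next
    case False
    then obtain l where l: "l \<in> I" "a n l \<noteq> 0" by auto
    define J where "J = I - {l}"
    have J: "finite J" "n < card J"
      using Suc.prems l by (auto simp: J_def)
    obtain x where x: "\<exists>i\<in>J. x i \<noteq> 0"
      "\<forall>j<n. (\<Sum>i\<in>J. (a j i - a j l / a n l * a n i) * x i) = 0"
      using Suc.IH[OF J, of "\<lambda>j i. a j i - a j l / a n l * a n i"] by auto
    define S where "S = (\<Sum>i\<in>J. a n i * x i)"
    \<comment> \<open>The eliminated unknown takes the value that equation \<open>n\<close>
      forces.\<close>
    define y where "y = x(l := - S / a n l)"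
    have split: "(\<Sum>i\<in>I. a j i * y i) = - a j l * S / a n l + (\<Sum>i\<in>J. a j i * x i)" for j
    proof -
      have "(\<Sum>i\<in>I. a j i * y i) = a j l * y l + (\<Sum>i\<in>J. a j i * y i)"
        unfolding J_def using Suc.prems l by (simp add: sum.remove)
      moreover have "(\<Sum>i\<in>J. a j i * y i) = (\<Sum>i\<in>J. a j i * x i)"
        by (intro sum.cong) (auto simp: J_def y_def)
      ultimately show ?thesis by (simp add: y_def)
    qed
    have "(\<Sum>i\<in>I. a j i * y i) = 0" if "j < Suc n" for j
    proof (cases "j = n")
      case True
      then show ?thesis using l split[of n] by (simp add: S_def)
    next
      case False
      then have "(\<Sum>i\<in>J. (a j i - a j l / a n l * a n i) * x i) = 0"
        using x(2) that by simp
      also have "(\<Sum>i\<in>J. (a j i - a j l / a n l * a n i) * x i)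
          = (\<Sum>i\<in>J. a j i * x i) - a j l / a n l * S"
        by (simp add: S_def left_diff_distrib sum_subtractf sum_distrib_left mult.assoc)
      finally show ?thesis using split[of j] by simp
    qed
    moreover have "\<exists>i\<in>I. y i \<noteq> 0"
      using x(1) by (auto simp: J_def y_def)
    ultimately show ?thesis by blast
  qed
qed

section \<open>Unit vectors orthogonal to a given list\<close>

lemma unit_vector_orthogonal:
  fixes a :: "nat \<Rightarrow> nat \<Rightarrow> real"
  assumes "n < d"
  obtains v where "dot d v v = 1" "\<And>j. j < n \<Longrightarrow> dot d v (a j) = 0"
proof -
  obtain x where x: "\<exists>i\<in>{..<d}. x i \<noteq> 0" "\<forall>j<n. (\<Sum>i<d. a j i * x i) = 0"
    using underdetermined_system[of "{..<d}" n a] assms by auto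
  have pos: "0 < dot d x x"
    unfolding dot_def using x(1) by (auto intro!: sum_pos2 simp: zero_less_mult_iff)
  define v where "v = (\<lambda>i. (1 / sqrt (dot d x x)) * x i)"
  have "dot d v v = 1"
  proof -
    have "dot d v v = (1 / sqrt (dot d x x)) * dot d x v"
      unfolding v_def by (rule dot_scale_left)
    also have "dot d x v = (1 / sqrt (dot d x x)) * dot d x x"
      unfolding dot_commute[of d x v] unfolding v_def by (rule dot_scale_left)
    finally show ?thesis
      using pos by (simp add: field_simps)
  qed
  moreover have "dot d v (a j) = 0" if "j < n" for j
    using x(2) that unfolding v_def dot_scale_left by (simp add: dot_def mult.commute)
  ultimately show ?thesis by (rule that)
qed

lemma orthonormal_family_orthogonal:
  fixes a :: "nat \<Rightarrow> nat \<Rightarrow> real"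
  assumes "n + m \<le> d"
  shows "\<exists>W. orthonormal d m W \<and> (\<forall>i<m. \<forall>j<n. dot d (W i) (a j) = 0)"
  using assms
proof (induction m)
  case 0
  then show ?case by (simp add: orthonormal_def)
next
  case (Suc m)
  then obtain W where W: "orthonormal d m W" "\<forall>i<m. \<forall>j<n. dot d (W i) (a j) = 0"
    by auto
  obtain v where v: "dot d v v = 1"
    "\<And>j. j < n + m \<Longrightarrow> dot d v (if j < n then a j else W (j - n)) = 0"
    using unit_vector_orthogonal[of "n + m" d "\<lambda>j. if j < n then a j else W (j - n)"] Suc.prems
    by auto
  have va: "dot d v (a j) = 0" if "j < n" for j
    using v(2)[of j] that by simp
  have vW: "dot d v (W i) = 0" if "i < m" for i
    using v(2)[of "n + i"] that by simp
  have "orthonormal d (Suc m) (W(m := v))"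
    using W(1) v(1) vW unfolding orthonormal_def
    by (auto simp: less_Suc_eq dot_commute[of d "W i" v for i])
  moreover have "\<forall>i<Suc m. \<forall>j<n. dot d ((W(m := v)) i) (a j) = 0"
    using W(2) va by (auto simp: less_Suc_eq)
  ultimately show ?case by blast
qed

text \<open>A random sign is subgaussian: \<open>cosh x\<close> is its exponential moment. The
  derivative of \<open>g\<close> is \<open>y - tanh y\<close>, nonnegative for
  \<open>y >= 0\<close>.\<close>

lemma cosh_le_exp_half_square: "cosh (x::real) \<le> exp (x\<^sup>2 / 2)"
proof -
  define g where "g y = y\<^sup>2 / 2 - ln (cosh y)" for y :: real
  have sinh: "sinh y \<le> y * cosh y" if "0 \<le> y" for y :: real
  proof -
    have "((\<lambda>y. y * cosh y - sinh y) has_real_derivative y * sinh y) (at y)" for y :: real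
      by (auto intro!: derivative_eq_intros)
    then have "0 * cosh 0 - sinh 0 \<le> y * cosh y - sinh y"
      by (intro DERIV_nonneg_imp_nondecreasing[OF that]) (metis sinh_real_nonneg_iff zero_le_mult_iff)
    then show ?thesis by simp
  qed
  have "(g has_real_derivative y - sinh y / cosh y) (at y)" for y
    unfolding g_def by (auto intro!: derivative_eq_intros)
  moreover have "0 \<le> y - sinh y / cosh y" if "0 \<le> y" for y :: real
    using sinh[OF that] by (simp add: divide_le_eq)
  ultimately have "g 0 \<le> g \<bar>x\<bar>"
    by (intro DERIV_nonneg_imp_nondecreasing[of 0 "\<bar>x\<bar>" g]) (simp, blast)
  then have "ln (cosh \<bar>x\<bar>) \<le> x\<^sup>2 / 2"
    by (simp add: g_def)
  then show ?thesis
    using exp_le_cancel_iff[of "ln (cosh x)" "x\<^sup>2 / 2"] cosh_real_pos[of x] by (simp add: exp_ln)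
qed

text \<open>Derandomised Hoeffding bound: the signs are chosen by the method of conditional
  expectations.\<close>

lemma balancing_signs:
  fixes b :: "nat \<Rightarrow> nat \<Rightarrow> real"
  assumes "\<And>t. t < N \<Longrightarrow> 0 \<le> c t"
  shows "\<exists>e. (\<forall>i<m. e i = 1 \<or> e i = - 1) \<and>
    (\<Sum>t<N. c t * cosh (\<Sum>i<m. e i * b t i)) \<le> (\<Sum>t<N. c t * exp ((\<Sum>i<m. (b t i)\<^sup>2) / 2))"
  using assms
proof (induction m arbitrary: c)
  case 0
  then show ?case by simp
next
  case (Suc m)
  \<comment> \<open>The last sign is averaged out first: its factor \<open>cosh (b t m)\<close>
    joins the coefficients, which is why \<open>c\<close> is general.\<close>
  obtain e where e: "\<forall>i<m. e i = 1 \<or> e i = - 1"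
    "(\<Sum>t<N. c t * cosh (b t m) * cosh (\<Sum>i<m. e i * b t i))
      \<le> (\<Sum>t<N. c t * cosh (b t m) * exp ((\<Sum>i<m. (b t i)\<^sup>2) / 2))"
    using Suc.IH[of "\<lambda>t. c t * cosh (b t m)"] Suc.prems by auto
  define S where "S t = (\<Sum>i<m. e i * b t i)" for t
  have bound: "(\<Sum>t<N. c t * cosh (b t m) * exp ((\<Sum>i<m. (b t i)\<^sup>2) / 2))
      \<le> (\<Sum>t<N. c t * exp ((\<Sum>i<Suc m. (b t i)\<^sup>2) / 2))"
  proof (rule sum_mono)
    fix t assume "t \<in> {..<N}"
    then have "0 \<le> c t" using Suc.prems by simp
    moreover have "cosh (b t m) * exp ((\<Sum>i<m. (b t i)\<^sup>2) / 2)
        \<le> exp ((\<Sum>i<Suc m. (b t i)\<^sup>2) / 2)"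
      using mult_right_mono[OF cosh_le_exp_half_square[of "b t m"], of "exp ((\<Sum>i<m. (b t i)\<^sup>2) / 2)"]
      by (simp add: exp_add[symmetric] add_divide_distrib add.commute)
    ultimately show "c t * cosh (b t m) * exp ((\<Sum>i<m. (b t i)\<^sup>2) / 2)
        \<le> c t * exp ((\<Sum>i<Suc m. (b t i)\<^sup>2) / 2)"
      by (simp add: mult_left_mono mult.assoc)
  qed
  \<comment> \<open>One of the two choices of the last sign does at most as badly as their
    average.\<close>
  have "(\<Sum>t<N. c t * cosh (S t + b t m)) + (\<Sum>t<N. c t * cosh (S t - b t m))
      = 2 * (\<Sum>t<N. c t * cosh (b t m) * cosh (S t))"
    by (simp add: sum.distrib[symmetric] sum_distrib_left cosh_add cosh_diff algebra_simps)
  then have "(\<Sum>t<N. c t * cosh (S t + b t m)) \<le> (\<Sum>t<N. c t * cosh (b t m) * cosh (S t))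
      \<or> (\<Sum>t<N. c t * cosh (S t - b t m)) \<le> (\<Sum>t<N. c t * cosh (b t m) * cosh (S t))"
    by linarith
  then obtain \<sigma> :: real where \<sigma>: "\<sigma> = 1 \<or> \<sigma> = - 1"
    "(\<Sum>t<N. c t * cosh (S t + \<sigma> * b t m)) \<le> (\<Sum>t<N. c t * cosh (b t m) * cosh (S t))"
  proof
    assume "(\<Sum>t<N. c t * cosh (S t + b t m)) \<le> (\<Sum>t<N. c t * cosh (b t m) * cosh (S t))"
    then show thesis by (intro that[of 1]) auto
  next
    assume "(\<Sum>t<N. c t * cosh (S t - b t m)) \<le> (\<Sum>t<N. c t * cosh (b t m) * cosh (S t))"
    then show thesis by (intro that[of "- 1"]) auto
  qed
  have "(\<Sum>i<Suc m. (e(m := \<sigma>)) i * b t i) = S t + \<sigma> * b t m" for t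
    by (simp add: S_def)
  then have "(\<Sum>t<N. c t * cosh (\<Sum>i<Suc m. (e(m := \<sigma>)) i * b t i))
      \<le> (\<Sum>t<N. c t * exp ((\<Sum>i<Suc m. (b t i)\<^sup>2) / 2))"
    using \<sigma>(2) e(2) bound unfolding S_def by simp
  moreover have "\<forall>i<Suc m. (e(m := \<sigma>)) i = 1 \<or> (e(m := \<sigma>)) i = - 1"
    using e(1) \<sigma>(1) by (auto simp: less_Suc_eq)
  ultimately show ?case by blast
qed

text \<open>\<open>v\<close> is a normalised signed sum of \<open>m\<close> orthonormal vectors
  orthogonal to all \<open>a j\<close>. With balanced signs its inner products with the
  \<open>x t\<close> are small at a cost only logarithmic in \<open>N\<close>, so \<open>N\<close>
  may far exceed \<open>d\<close>.\<close>

lemma nearly_orthogonal_unit_vector: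
  fixes a x :: "nat \<Rightarrow> nat \<Rightarrow> real"
  assumes m: "n + m \<le> d" "0 < m" and "0 < R" "0 < s"
    and x: "\<And>t. t < N \<Longrightarrow> nrm d (x t) \<le> R"
    and large: "2 * ln (2 * real N) * R\<^sup>2 \<le> s\<^sup>2 * real m"
  obtains v where "dot d v v = 1" "\<And>j. j < n \<Longrightarrow> dot d v (a j) = 0"
    "\<And>t. t < N \<Longrightarrow> \<bar>dot d v (x t)\<bar> \<le> s"
proof -
  obtain W where W: "orthonormal d m W" "\<forall>i<m. \<forall>j<n. dot d (W i) (a j) = 0"
    using orthonormal_family_orthogonal[OF m(1), of a] by blast
  \<comment> \<open>Chernoff parameter: it maximises
    \<open>\<theta> * s - \<theta> ^ 2 * R ^ 2 / (2 * m)\<close>.\<close>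
  define \<theta> where "\<theta> = s * real m / R\<^sup>2"
  have \<theta>: "0 < \<theta>" using assms by (simp add: \<theta>_def)
  define q where "q = 1 / sqrt (real m)"
  have q: "q\<^sup>2 = 1 / real m" using m by (simp add: q_def power_divide)
  define b where "b t i = \<theta> * q * dot d (W i) (x t)" for t i
  obtain e :: "nat \<Rightarrow> real" where e: "\<forall>i<m. e i = 1 \<or> e i = - 1"
    "(\<Sum>t<N. cosh (\<Sum>i<m. e i * b t i)) \<le> (\<Sum>t<N. exp ((\<Sum>i<m. (b t i)\<^sup>2) / 2))"
    using balancing_signs[of N "\<lambda>_. 1" m b] by auto
  define v where "v = (\<lambda>i. \<Sum>l<m. (q * e l) * W l i)"
  have "dot d v v = (\<Sum>l<m. (q * e l)\<^sup>2)"
    unfolding v_def by (rule dot_combination_self[OF W(1)])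
  also have "\<dots> = (\<Sum>l<m. 1 / real m)"
    using e(1) q by (intro sum.cong) (auto simp: power_mult_distrib)
  also have "\<dots> = 1" using m by simp
  finally have 1: "dot d v v = 1" .
  have 2: "dot d v (a j) = 0" if "j < n" for j
    using W(2) that unfolding v_def dot_sum_left by simp
  have 3: "\<bar>dot d v (x t)\<bar> \<le> s" if "t < N" for t
  proof -
    have N: "0 < N" using that by simp
    have be: "(\<Sum>i<m. e i * b t i) = \<theta> * dot d v (x t)"
      unfolding v_def dot_sum_left b_def by (simp add: sum_distrib_left algebra_simps)
    have bb: "(\<Sum>i<m. (b u i)\<^sup>2) \<le> \<theta>\<^sup>2 * R\<^sup>2 / real m" if "u < N" for u
    proof -
      have "(\<Sum>i<m. (b u i)\<^sup>2) = \<theta>\<^sup>2 / real m * (\<Sum>i<m. (dot d (W i) (x u))\<^sup>2)"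
        by (simp add: b_def power_mult_distrib q sum_distrib_left)
      also have "\<dots> \<le> \<theta>\<^sup>2 / real m * R\<^sup>2"
        using bessel[OF W(1), of "x u"] x[OF that] nrm_le_iff[of R "x u" d] \<open>0 < R\<close>
        by (intro mult_left_mono) auto
      finally show ?thesis by simp
    qed
    \<comment> \<open>Each term of the potential is at least half an exponential; this factor and
      the number of terms make up \<open>2 * N\<close> in the logarithm.\<close>
    have "exp \<bar>\<theta> * dot d v (x t)\<bar> / 2 \<le> cosh \<bar>\<theta> * dot d v (x t)\<bar>"
      by (simp add: cosh_def)
    also have "\<dots> = cosh (\<Sum>i<m. e i * b t i)"
      unfolding be by (simp add: abs_if)
    also have "\<dots> \<le> (\<Sum>t<N. cosh (\<Sum>i<m. e i * b t i))"
      using that by (intro member_le_sum) auto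
    also have "\<dots> \<le> (\<Sum>t<N. exp ((\<Sum>i<m. (b t i)\<^sup>2) / 2))"
      by (rule e(2))
    also have "\<dots> \<le> (\<Sum>t<N. exp (\<theta>\<^sup>2 * R\<^sup>2 / real m / 2))"
      using bb by (intro sum_mono) simp
    also have "\<dots> = exp (ln (real N) + \<theta>\<^sup>2 * R\<^sup>2 / real m / 2)"
      using N by (simp add: exp_add)
    finally have "exp \<bar>\<theta> * dot d v (x t)\<bar> \<le> exp (ln (2 * real N) + \<theta>\<^sup>2 * R\<^sup>2 / real m / 2)"
      using N by (simp add: exp_add)
    then have "\<theta> * \<bar>dot d v (x t)\<bar> \<le> ln (2 * real N) + \<theta>\<^sup>2 * R\<^sup>2 / real m / 2"
      using \<theta> by (simp add: abs_mult)
    also have "\<theta>\<^sup>2 * R\<^sup>2 / real m / 2 = s\<^sup>2 * real m / R\<^sup>2 / 2"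
      using assms by (simp add: \<theta>_def power2_eq_square field_simps)
    also have "ln (2 * real N) \<le> s\<^sup>2 * real m / R\<^sup>2 / 2"
      using large \<open>0 < R\<close> by (simp add: field_simps)
    finally have "\<theta> * \<bar>dot d v (x t)\<bar> \<le> \<theta> * s"
      by (simp add: \<theta>_def power2_eq_square mult_ac)
    then show ?thesis using \<theta> by simp
  qed
  show ?thesis by (rule that[OF 1 2 3])
qed

section \<open>A local smoothing of the maximum\<close>

definition prob_simplex :: "nat \<Rightarrow> (nat \<Rightarrow> real) set" where
  "prob_simplex k = {l. (\<forall>j<k. 0 \<le> l j) \<and> (\<Sum>j<k. l j) = 1}"

text \<open>The penalty is quadratic rather than entropic because its maximisers over the simplex
  can have exact zeros, which makes the smoothing local.\<close>

definition pen_avg :: "nat \<Rightarrow> real \<Rightarrow> (nat \<Rightarrow> real) \<Rightarrow> (nat \<Rightarrow> real) \<Rightarrow> real" where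
  "pen_avg k s a l = (\<Sum>j<k. l j * a j) - s / 2 * (\<Sum>j<k. (l j)\<^sup>2)"

text \<open>The condition below is the KKT system of the problem of maximising \<^const>\<open>pen_avg\<close> over the
  simplex, with \<open>\<tau>\<close> the multiplier of the constraint that the weights sum to 1.\<close>

definition weights :: "nat \<Rightarrow> real \<Rightarrow> (nat \<Rightarrow> real) \<Rightarrow> (nat \<Rightarrow> real)" where
  "weights k s a = (SOME l. l \<in> prob_simplex k \<and> (\<exists>\<tau>. \<forall>j<k. s * l j = max 0 (a j - \<tau>)))"

text \<open>For positive \<open>k\<close> and \<open>s\<close> this is the Moreau envelope, with
  parameter \<open>s\<close>, of the maximum of the entries.\<close>

definition smax :: "nat \<Rightarrow> real \<Rightarrow> (nat \<Rightarrow> real) \<Rightarrow> real" where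
  "smax k s a = pen_avg k s a (weights k s a)"

text \<open>Water filling: the total excess of the entries over a level is continuous in the level,
  at least \<open>s\<close> at \<open>M - s\<close> and 0 at \<open>M\<close>. At the level where it
  equals \<open>s\<close>, the excesses divided by \<open>s\<close> are the weights.\<close>

lemma weights_exist:
  assumes "0 < k" "0 < s"
  shows "\<exists>l. l \<in> prob_simplex k \<and> (\<exists>\<tau>. \<forall>j<k. s * l j = max 0 (a j - \<tau>))"
proof -
  define g where "g \<tau> = (\<Sum>j<k. max 0 (a j - \<tau>))" for \<tau>
  define M where "M = Max (a ` {..<k})"
  have M: "a j \<le> M" if "j < k" for j
    using that by (simp add: M_def)
  have "M \<in> a ` {..<k}"
    unfolding M_def using assms by (intro Max_in) auto
  then obtain i where i: "i < k" "a i = M" by auto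
  have "g M = 0"
    unfolding g_def using M by (intro sum.neutral) (auto simp: max_def intro: antisym)
  moreover have "s \<le> g (M - s)"
  proof -
    have "s \<le> max 0 (a i - (M - s))" using i by simp
    also have "\<dots> \<le> g (M - s)"
      unfolding g_def using i(1) by (intro member_le_sum) auto
    finally show ?thesis .
  qed
  moreover have "continuous_on {M - s..M} g"
    unfolding g_def by (intro continuous_intros)
  ultimately obtain \<tau> where \<tau>: "g \<tau> = s"
    using IVT2'[of g M s "M - s"] assms by auto
  have "(\<lambda>j. max 0 (a j - \<tau>) / s) \<in> prob_simplex k"
    using assms \<tau> by (simp add: prob_simplex_def g_def sum_divide_distrib[symmetric])
  moreover have "\<forall>j<k. s * (max 0 (a j - \<tau>) / s) = max 0 (a j - \<tau>)"
    using assms by simp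
  ultimately show ?thesis by blast
qed

lemma weights_props:
  assumes "0 < k" "0 < s"
  shows "weights k s a \<in> prob_simplex k"
    and "\<exists>\<tau>. \<forall>j<k. s * weights k s a j = max 0 (a j - \<tau>)"
  using someI_ex[OF weights_exist[OF assms, of a]] unfolding weights_def by auto

lemma prob_simplex_le_one:
  assumes "l \<in> prob_simplex k" "j < k"
  shows "l j \<le> 1"
  using member_le_sum[of j "{..<k}" l] assms by (auto simp: prob_simplex_def)

text \<open>No weight exceeds 1, so the level \<open>\<tau>\<close> is at least
  \<open>a i - s\<close>, and entry \<open>j\<close> does not rise above it.\<close>

lemma weights_eq_0:
  assumes "0 < k" "0 < s" "i < k" "j < k" "a j \<le> a i - s"
  shows "weights k s a j = 0"
proof -
  obtain \<tau> where \<tau>: "\<And>j. j < k \<Longrightarrow> s * weights k s a j = max 0 (a j - \<tau>)"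
    using weights_props(2)[OF assms(1,2), of a] by blast
  have "a i - \<tau> \<le> s * weights k s a i"
    using \<tau>[OF assms(3)] by simp
  also have "\<dots> \<le> s"
    using prob_simplex_le_one[OF weights_props(1)[OF assms(1,2)] assms(3)] assms by simp
  finally have "s * weights k s a j = 0"
    using \<tau>[OF assms(4)] assms(5) by simp
  then show ?thesis using assms by simp
qed

text \<open>Strong concavity of \<open>pen_avg\<close> at its maximiser, read off from the KKT
  system.\<close>

lemma smax_optimal:
  assumes "0 < k" "0 < s" "l \<in> prob_simplex k"
  shows "pen_avg k s a l + s / 2 * (\<Sum>j<k. (weights k s a j - l j)\<^sup>2) \<le> smax k s a"
proof -
  let ?w = "weights k s a"
  obtain \<tau> where \<tau>: "\<And>j. j < k \<Longrightarrow> s * ?w j = max 0 (a j - \<tau>)"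
    using weights_props(2)[OF assms(1,2), of a] by blast
  have w: "?w \<in> prob_simplex k" by (rule weights_props(1)[OF assms(1,2)])
  have "smax k s a - pen_avg k s a l - s / 2 * (\<Sum>j<k. (?w j - l j)\<^sup>2)
      = (\<Sum>j<k. ?w j * a j - s / 2 * (?w j)\<^sup>2 - (l j * a j - s / 2 * (l j)\<^sup>2) - s / 2 * (?w j - l j)\<^sup>2)"
    by (simp add: smax_def pen_avg_def sum_subtractf sum_distrib_left)
  \<comment> \<open>The quadratic terms recombine exactly into the KKT residual; the multiplier term
    vanishes later because both weight vectors sum to 1.\<close>
  also have "\<dots> = (\<Sum>j<k. (?w j - l j) * (a j - s * ?w j - \<tau>) + \<tau> * (?w j - l j))"
    by (intro sum.cong) (auto simp: power2_eq_square field_simps)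
  also have "\<dots> = (\<Sum>j<k. (?w j - l j) * (a j - s * ?w j - \<tau>)) + \<tau> * ((\<Sum>j<k. ?w j) - (\<Sum>j<k. l j))"
    by (simp add: sum.distrib flip: sum_subtractf sum_distrib_left)
  also have "\<dots> = (\<Sum>j<k. (?w j - l j) * (a j - s * ?w j - \<tau>))"
    using w assms(3) by (simp add: prob_simplex_def)
  \<comment> \<open>Complementary slackness: up to the level the weight is 0, above it the residual
    is 0.\<close>
  also have "\<dots> \<ge> 0"
  proof (rule sum_nonneg)
    fix j assume "j \<in> {..<k}"
    then have j: "j < k" by simp
    show "0 \<le> (?w j - l j) * (a j - s * ?w j - \<tau>)"
    proof (cases "a j \<le> \<tau>")
      case True
      then have "s * ?w j = 0" using \<tau>[OF j] by simp
      then have "?w j = 0" using assms by simp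
      then show ?thesis
        using True assms(3) j by (simp add: prob_simplex_def mult_nonneg_nonpos)
    next
      case False
      then show ?thesis using \<tau>[OF j] by simp
    qed
  qed
  finally show ?thesis by linarith
qed

section \<open>Estimates, smoothness and locality of the smoothed maximum\<close>

lemma smax_ge:
  assumes "0 < k" "0 < s" "l \<in> prob_simplex k"
  shows "pen_avg k s a l \<le> smax k s a"
proof -
  have "0 \<le> s / 2 * (\<Sum>j<k. (weights k s a j - l j)\<^sup>2)"
    using assms by (intro mult_nonneg_nonneg sum_nonneg) auto
  then show ?thesis using smax_optimal[OF assms, of a] by linarith
qed

text \<open>Tested at vertex \<open>i\<close> of the simplex, where the penalty is
  \<open>s / 2\<close>.\<close>

lemma smax_ge_entry:
  assumes "0 < k" "0 < s" "i < k"
  shows "a i - s / 2 \<le> smax k s a"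
proof -
  have eq: "(\<Sum>j<k. (if j = i then 1 else 0 :: real) * a j) = (\<Sum>j<k. if j = i then a j else 0)"
    by (intro sum.cong) auto
  have eq2: "(\<Sum>j<k. (if j = i then 1 else 0 :: real)\<^sup>2) = (\<Sum>j<k. if j = i then 1 else 0)"
    by (intro sum.cong) auto
  have "(\<lambda>j. if j = i then 1 else 0) \<in> prob_simplex k"
    using assms by (simp add: prob_simplex_def)
  from smax_ge[OF assms(1,2) this, of a] show ?thesis
    unfolding pen_avg_def eq eq2 using assms(3) by simp
qed

lemma smax_ge_average:
  assumes "0 < k" "0 < s"
  shows "(\<Sum>j<k. a j) / real k - s / (2 * real k) \<le> smax k s a"
proof -
  have "(\<lambda>_. 1 / real k) \<in> prob_simplex k"
    using assms by (simp add: prob_simplex_def)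
  from smax_ge[OF assms(1,2) this, of a] show ?thesis
    using assms by (simp add: pen_avg_def sum_divide_distrib[symmetric] power2_eq_square field_simps)
qed

lemma smax_le:
  assumes "0 < k" "0 < s" "\<And>j. j < k \<Longrightarrow> a j \<le> M"
  shows "smax k s a \<le> M"
proof -
  let ?w = "weights k s a"
  have w: "\<And>j. j < k \<Longrightarrow> 0 \<le> ?w j" "(\<Sum>j<k. ?w j) = 1"
    using weights_props(1)[OF assms(1,2), of a] by (auto simp: prob_simplex_def)
  have "(\<Sum>j<k. ?w j * a j) \<le> (\<Sum>j<k. ?w j * M)"
    using assms(3) w(1) by (intro sum_mono mult_left_mono) auto
  also have "\<dots> = M"
    using w(2) by (simp add: sum_distrib_right[symmetric])
  finally have "(\<Sum>j<k. ?w j * a j) \<le> M" .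
  moreover have "0 \<le> s / 2 * (\<Sum>j<k. (?w j)\<^sup>2)"
    using assms by (intro mult_nonneg_nonneg sum_nonneg) auto
  ultimately show ?thesis by (simp add: smax_def pen_avg_def)
qed

lemma pen_avg_diff: "pen_avg k s b l = pen_avg k s a l + (\<Sum>j<k. l j * (b j - a j))"
  by (simp add: pen_avg_def right_diff_distrib sum_subtractf)

text \<open>Optimality at \<open>b\<close> is tested with the weights of \<open>a\<close>. The
  quadratic term is kept because it carries the smoothness of \<open>smax\<close>.\<close>

lemma smax_subgradient:
  assumes "0 < k" "0 < s"
  shows "smax k s a + (\<Sum>j<k. weights k s a j * (b j - a j))
      + s / 2 * (\<Sum>j<k. (weights k s b j - weights k s a j)\<^sup>2) \<le> smax k s b"
  using smax_optimal[OF assms weights_props(1)[OF assms], of b a]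
  by (simp add: pen_avg_diff[of k s b _ a] smax_def)

lemma sum_square_combination:
  fixes D c :: "nat \<Rightarrow> real"
  shows "(\<Sum>j<k. (s * D j + c j)\<^sup>2) = s\<^sup>2 * (\<Sum>j<k. (D j)\<^sup>2) + 2 * s * (\<Sum>j<k. D j * c j) + (\<Sum>j<k. (c j)\<^sup>2)"
  by (simp add: power2_sum power_mult_distrib sum.distrib sum_distrib_left mult_ac)

text \<open>Adding the subgradient inequalities in both directions makes the weights cocoercive; a
  completed square then replaces Cauchy-Schwarz.\<close>

lemma weights_lipschitz:
  assumes "0 < k" "0 < s"
  shows "s\<^sup>2 * (\<Sum>j<k. (weights k s b j - weights k s a j)\<^sup>2) \<le> (\<Sum>j<k. (b j - a j)\<^sup>2)"
proof -
  let ?D = "\<lambda>j. weights k s b j - weights k s a j"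
  let ?c = "\<lambda>j. b j - a j"
  have sym: "(\<Sum>j<k. (weights k s a j - weights k s b j)\<^sup>2) = (\<Sum>j<k. (?D j)\<^sup>2)"
    by (simp add: power2_commute)
  have "(\<Sum>j<k. weights k s b j * (a j - b j)) + (\<Sum>j<k. weights k s a j * (b j - a j))
      = - (\<Sum>j<k. ?D j * ?c j)"
    by (simp add: sum.distrib[symmetric] sum_negf[symmetric] algebra_simps)
  then have 1: "s * (\<Sum>j<k. (?D j)\<^sup>2) \<le> (\<Sum>j<k. ?D j * ?c j)"
    using smax_subgradient[OF assms, of a b] smax_subgradient[OF assms, of b a] unfolding sym
    by (simp add: field_simps)
  have "0 \<le> (\<Sum>j<k. (s * ?D j - ?c j)\<^sup>2)"
    by (intro sum_nonneg) auto
  also have "\<dots> = s\<^sup>2 * (\<Sum>j<k. (?D j)\<^sup>2) - 2 * s * (\<Sum>j<k. ?D j * ?c j) + (\<Sum>j<k. (?c j)\<^sup>2)"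
    using sum_square_combination[of s ?D "\<lambda>j. - ?c j" k] by (simp add: sum_negf del: minus_diff_eq)
  finally have "0 \<le> s\<^sup>2 * (\<Sum>j<k. (?D j)\<^sup>2) - 2 * s * (\<Sum>j<k. ?D j * ?c j) + (\<Sum>j<k. (?c j)\<^sup>2)" .
  moreover have "2 * s * (s * (\<Sum>j<k. (?D j)\<^sup>2)) \<le> 2 * s * (\<Sum>j<k. ?D j * ?c j)"
    using 1 assms by (intro mult_left_mono) auto
  ultimately show ?thesis by (simp add: power2_eq_square mult.assoc)
qed

text \<open>In the subgradient inequality at \<open>b\<close>, the quadratic term absorbs the change
  of weights by Young's inequality.\<close>

lemma smax_upper:
  assumes "0 < k" "0 < s"
  shows "smax k s b \<le> smax k s a + (\<Sum>j<k. weights k s a j * (b j - a j))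
      + (\<Sum>j<k. (b j - a j)\<^sup>2) / (2 * s)"
proof -
  let ?D = "\<lambda>j. weights k s a j - weights k s b j"
  let ?c = "\<lambda>j. b j - a j"
  have "0 \<le> (\<Sum>j<k. (s * ?D j + ?c j)\<^sup>2) / (2 * s)"
    using assms by (intro divide_nonneg_nonneg sum_nonneg) auto
  also have "(\<Sum>j<k. (s * ?D j + ?c j)\<^sup>2)
      = s\<^sup>2 * (\<Sum>j<k. (?D j)\<^sup>2) + 2 * s * (\<Sum>j<k. ?D j * ?c j) + (\<Sum>j<k. (?c j)\<^sup>2)"
    by (rule sum_square_combination)
  also have "\<dots> / (2 * s) = s / 2 * (\<Sum>j<k. (?D j)\<^sup>2) + (\<Sum>j<k. ?D j * ?c j) + (\<Sum>j<k. (?c j)\<^sup>2) / (2 * s)"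
    using assms by (simp add: add_divide_distrib power2_eq_square)
  finally have "0 \<le> s / 2 * (\<Sum>j<k. (?D j)\<^sup>2) + (\<Sum>j<k. ?D j * ?c j) + (\<Sum>j<k. (?c j)\<^sup>2) / (2 * s)" .
  moreover have "(\<Sum>j<k. weights k s b j * (a j - b j)) + (\<Sum>j<k. weights k s a j * ?c j)
      = (\<Sum>j<k. ?D j * ?c j)"
    by (simp add: sum.distrib[symmetric] algebra_simps)
  ultimately show ?thesis
    using smax_subgradient[OF assms, of b a] by linarith
qed

text \<open>Entries of \<open>a\<close> that may differ from those of \<open>b\<close> carry no
  weight at \<open>a\<close>, so the weights of \<open>a\<close> yield the same penalised average
  for \<open>b\<close>.\<close>

lemma smax_local_le:
  assumes "0 < k" "0 < s"
    and "\<And>j. j < k \<Longrightarrow> a j = b j \<or> (\<exists>i<k. a j \<le> a i - s)"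
  shows "smax k s a \<le> smax k s b"
proof -
  let ?w = "weights k s a"
  have "(\<Sum>j<k. ?w j * (b j - a j)) = 0"
    using assms(3) weights_eq_0[OF assms(1,2)] by (intro sum.neutral) fastforce
  then have "pen_avg k s b ?w = smax k s a"
    unfolding pen_avg_diff[of k s b _ a] smax_def by simp
  then show ?thesis
    using smax_ge[OF assms(1,2) weights_props(1)[OF assms(1,2)], of b a] by simp
qed

section \<open>Smooth strongly convex functions\<close>

lemma tendsto_coordinate: "((\<lambda>y. y i) \<longlongrightarrow> x i) (at x within S)" for x :: "nat \<Rightarrow> real"
  using continuous_on_product_coordinates[of i] unfolding continuous_on_def
  by (metis UNIV_I subset_UNIV tendsto_within_subset)

lemma tendsto_nrm_vdiff: "((\<lambda>y. nrm d (vdiff d y x)) \<longlongrightarrow> 0) (at x within S)"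
proof -
  have "((\<lambda>y. sqrt (\<Sum>i<d. (y i - x i)\<^sup>2)) \<longlongrightarrow> sqrt (\<Sum>i<d. (x i - x i)\<^sup>2)) (at x within S)"
    by (intro tendsto_intros tendsto_coordinate)
  then show ?thesis by (simp add: L2_set_def vdiff_def)
qed

lemma tendsto_dot_vdiff: "((\<lambda>y. dot d g (vdiff d y x)) \<longlongrightarrow> 0) (at x within S)"
proof -
  have "((\<lambda>y. \<Sum>i<d. g i * (y i - x i)) \<longlongrightarrow> (\<Sum>i<d. g i * (x i - x i))) (at x within S)"
    by (intro tendsto_intros tendsto_coordinate)
  then show ?thesis by (simp add: dot_def vdiff_def)
qed

lemma abs_coordinate_le_nrm: "i < d \<Longrightarrow> \<bar>x i\<bar> \<le> nrm d x"
  using member_le_L2_set[of "{..<d}" i "\<lambda>j. \<bar>x j\<bar>"] by (simp add: L2_set_def)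

text \<open>Coordinates beyond \<open>d\<close> are confined to the single value
  \<open>undefined\<close>, so the set is a product of compact sets over all indices.\<close>

lemma compact_box: "compact {x \<in> Rd d. \<forall>i<d. \<bar>x i\<bar> \<le> \<rho>}"
proof -
  have "{x \<in> Rd d. \<forall>i<d. \<bar>x i\<bar> \<le> \<rho>} = PiE UNIV (\<lambda>i. if i < d then {-\<rho>..\<rho>} else {undefined})"
    by (auto simp: Rd_def PiE_def Pi_def extensional_def abs_le_iff minus_le_iff split: if_splits)
  moreover have "compact (PiE UNIV (\<lambda>i::nat. if i < d then {-\<rho>..\<rho>} else {undefined}))"
    using compactin_PiE[of "\<lambda>_. euclidean" "UNIV :: nat set" "\<lambda>i. if i < d then {-\<rho>..\<rho>} else {undefined}"]
    by (simp add: euclidean_product_topology)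
  ultimately show ?thesis by simp
qed

lemma vdiff_eq_0D:
  assumes "x \<in> Rd d" "y \<in> Rd d" "nrm d (vdiff d x y) = 0"
  shows "x = y"
proof
  fix i
  show "x i = y i"
  proof (cases "i < d")
    case True
    then show ?thesis
      using abs_coordinate_le_nrm[of i d "vdiff d x y"] assms(3) by (simp add: vdiff_def)
  next
    case False
    then show ?thesis using assms(1,2) by (auto simp: Rd_def PiE_def extensional_def)
  qed
qed

text \<open>The quadratic bounds on both sides of the linearisation can be verified by algebra;
  squeezed between them, \<open>f\<close> is differentiable with gradient \<open>G\<close>.\<close>

locale strongly_convex_smooth =
  fixes d :: nat and f :: "(nat \<Rightarrow> real) \<Rightarrow> real" and G :: "(nat \<Rightarrow> real) \<Rightarrow> (nat \<Rightarrow> real)"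
    and \<mu> \<beta> L :: real
  assumes \<mu>_pos: "0 < \<mu>"
    and G_Rd: "\<And>x. x \<in> Rd d \<Longrightarrow> G x \<in> Rd d"
    and lower: "\<And>x y. x \<in> Rd d \<Longrightarrow> y \<in> Rd d \<Longrightarrow>
      f x + dot d (G x) (vdiff d y x) + \<mu> / 2 * (nrm d (vdiff d y x))\<^sup>2 \<le> f y"
    and upper: "\<And>x y. x \<in> Rd d \<Longrightarrow> y \<in> Rd d \<Longrightarrow>
      f y \<le> f x + dot d (G x) (vdiff d y x) + L / 2 * (nrm d (vdiff d y x))\<^sup>2"
    and lipschitz: "\<And>x y. x \<in> Rd d \<Longrightarrow> y \<in> Rd d \<Longrightarrow>
      nrm d (vdiff d (G x) (G y)) \<le> \<beta> * nrm d (vdiff d x y)"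
begin

lemma has_gradient_G:
  assumes x: "x \<in> Rd d"
  shows "has_gradient d f (G x) x"
  unfolding has_gradient_def
proof
  let ?n = "\<lambda>y. nrm d (vdiff d y x)"
  have "\<bar>(f y - f x - dot d (G x) (vdiff d y x)) / ?n y\<bar> \<le> \<bar>L\<bar> / 2 * ?n y" if y: "y \<in> Rd d" for y
  \<comment> \<open>At zero norm the quotient is 0 by the convention for division by zero.\<close>
  proof (cases "?n y = 0")
    case False
    then have n: "0 < ?n y" by (simp add: order.not_eq_order_implies_strict L2_set_nonneg)
    have "L / 2 * (?n y)\<^sup>2 \<le> \<bar>L\<bar> / 2 * (?n y)\<^sup>2"
      by (intro mult_right_mono) auto
    moreover have "0 \<le> \<mu> / 2 * (?n y)\<^sup>2" using \<mu>_pos by simp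
    ultimately have "\<bar>f y - f x - dot d (G x) (vdiff d y x)\<bar> \<le> \<bar>L\<bar> / 2 * (?n y)\<^sup>2"
      using lower[OF x y] upper[OF x y] by linarith
    then show ?thesis
      using n by (simp add: abs_divide divide_le_eq power2_eq_square mult.assoc)
  qed simp
  then have "\<forall>\<^sub>F y in at x within Rd d.
      norm ((f y - f x - dot d (G x) (vdiff d y x)) / ?n y) \<le> \<bar>L\<bar> / 2 * ?n y"
    by (auto simp: eventually_at_filter)
  moreover have "((\<lambda>y. \<bar>L\<bar> / 2 * ?n y) \<longlongrightarrow> 0) (at x within Rd d)"
    by (rule tendsto_mult_right_zero[OF tendsto_nrm_vdiff])
  ultimately show "((\<lambda>y. (f y - f x - dot d (G x) (vdiff d y x)) / ?n y) \<longlongrightarrow> 0) (at x within Rd d)"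
    by (rule Lim_null_comparison)
qed (rule G_Rd[OF x])

lemma continuous_on_f: "continuous_on (Rd d) f"
  unfolding continuous_on_def
proof
  fix x assume x: "x \<in> Rd d"
  let ?n = "\<lambda>y. nrm d (vdiff d y x)"
  have lim: "((\<lambda>y. f x + dot d (G x) (vdiff d y x) + c * (?n y)\<^sup>2) \<longlongrightarrow> f x) (at x within Rd d)" for c
    by (auto intro!: tendsto_eq_intros tendsto_dot_vdiff tendsto_nrm_vdiff)
  show "(f \<longlongrightarrow> f x) (at x within Rd d)"
    using lower[OF x] upper[OF x]
    by (intro tendsto_sandwich[OF _ _ lim[of "\<mu> / 2"] lim[of "L / 2"]]) (auto simp: eventually_at_filter)
qed

lemma continuous_on_G: "continuous_on (Rd d) G"
proof (rule continuous_on_coordinatewise_then_product)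
  fix i
  show "continuous_on (Rd d) (\<lambda>x. G x i)"
  proof (cases "i < d")
    case True
    show ?thesis
      unfolding continuous_on_def
    proof
      fix x assume x: "x \<in> Rd d"
      have "\<bar>G y i - G x i\<bar> \<le> \<beta> * nrm d (vdiff d y x)" if "y \<in> Rd d" for y
        using abs_coordinate_le_nrm[OF True, of "vdiff d (G y) (G x)"] lipschitz[OF that x] True
        by (simp add: vdiff_def)
      then have "\<forall>\<^sub>F y in at x within Rd d. norm (G y i - G x i) \<le> \<beta> * nrm d (vdiff d y x)"
        by (auto simp: eventually_at_filter)
      moreover have "((\<lambda>y. \<beta> * nrm d (vdiff d y x)) \<longlongrightarrow> 0) (at x within Rd d)"
        by (rule tendsto_mult_right_zero[OF tendsto_nrm_vdiff])
      ultimately have "((\<lambda>y. G y i - G x i) \<longlongrightarrow> 0) (at x within Rd d)"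
        by (rule Lim_null_comparison)
      then show "((\<lambda>x. G x i) \<longlongrightarrow> G x i) (at x within Rd d)"
        by (simp add: LIM_zero_iff)
    qed
  next
    case False
    then have "G x i = undefined" if "x \<in> Rd d" for x
      using G_Rd[OF that] by (auto simp: Rd_def PiE_def extensional_def)
    then show ?thesis by (simp cong: continuous_on_cong)
  qed
qed

lemma minimizer_exists: "\<exists>x. is_minimizer d f x"
proof -
  define z where "z = (\<lambda>i\<in>{..<d}. 0 :: real)"
  have z: "z \<in> Rd d" by (simp add: z_def Rd_def)
  \<comment> \<open>Beyond this distance from the origin the quadratic term outweighs the linear
    one, so a minimum over the box is global.\<close>
  define \<rho> where "\<rho> = 2 * nrm d (G z) / \<mu>"
  have \<rho>: "0 \<le> \<rho>" using \<mu>_pos by (simp add: \<rho>_def L2_set_nonneg)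
  define K where "K = {x \<in> Rd d. \<forall>i<d. \<bar>x i\<bar> \<le> \<rho>}"
  have zK: "z \<in> K" using z \<rho> by (simp add: K_def z_def)
  have "continuous_on K f"
    using continuous_on_f by (rule continuous_on_subset) (auto simp: K_def)
  then obtain x where x: "x \<in> K" "\<And>y. y \<in> K \<Longrightarrow> f x \<le> f y"
    using continuous_attains_inf[of K f] compact_box[of d \<rho>] zK by (auto simp: K_def)
  have "f x \<le> f y" if y: "y \<in> Rd d" for y
  proof (cases "y \<in> K")
    case False
    then obtain i where i: "i < d" "\<rho> < \<bar>y i\<bar>"
      using y by (auto simp: K_def not_le)
    let ?n = "nrm d (vdiff d y z)"
    have "\<rho> \<le> ?n"
      using abs_coordinate_le_nrm[OF i(1), of "vdiff d y z"] i by (simp add: vdiff_def z_def)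
    then have "2 * nrm d (G z) \<le> \<mu> * ?n"
      using \<mu>_pos by (simp add: \<rho>_def divide_le_eq mult.commute)
    then have "2 * nrm d (G z) * ?n \<le> \<mu> * ?n * ?n"
      by (intro mult_right_mono) (auto simp: L2_set_nonneg)
    then have "nrm d (G z) * ?n \<le> \<mu> / 2 * ?n\<^sup>2"
      by (simp add: power2_eq_square)
    then have "f z \<le> f y"
      using dot_le_nrm[of d "G z" "vdiff d y z"] lower[OF z y] by linarith
    then show ?thesis using x(2)[OF zK] by linarith
  qed (rule x(2))
  then show ?thesis using x(1) by (auto simp: is_minimizer_def K_def)
qed

text \<open>At the midpoint \<open>m\<close> the linear terms towards \<open>x\<close> and
  \<open>y\<close> cancel, so distinct minimizers would force \<open>m\<close> strictly below the
  minimum.\<close>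

lemma minimizer_unique:
  assumes "is_minimizer d f x" "is_minimizer d f y"
  shows "x = y"
proof -
  have x: "x \<in> Rd d" and y: "y \<in> Rd d" and eq: "f x = f y"
    using assms by (auto simp: is_minimizer_def intro: antisym)
  define m where "m = (\<lambda>i\<in>{..<d}. (x i + y i) / 2)"
  have m: "m \<in> Rd d" by (simp add: m_def Rd_def)
  have "dot d (G m) (vdiff d x m) = - dot d (G m) (vdiff d y m)"
    unfolding dot_def sum_negf[symmetric]
    by (intro sum.cong) (auto simp: vdiff_def m_def field_simps)
  moreover have "f x \<le> f m" using assms m by (simp add: is_minimizer_def)
  moreover have "0 \<le> \<mu> / 2 * (nrm d (vdiff d y m))\<^sup>2" using \<mu>_pos by simp
  ultimately have "\<mu> / 2 * (nrm d (vdiff d x m))\<^sup>2 \<le> 0"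
    using lower[OF m x] lower[OF m y] eq by linarith
  then have "nrm d (vdiff d x m) = 0"
    using \<mu>_pos by (simp add: mult_le_0_iff)
  then have xm: "x = m" by (rule vdiff_eq_0D[OF x m])
  have "x i = y i" if "i < d" for i
  proof -
    have "x i = (x i + y i) / 2"
      using that fun_cong[OF xm, of i] unfolding m_def by simp
    then show ?thesis by simp
  qed
  then show ?thesis
    using x y by (auto simp: Rd_def intro: PiE_ext)
qed

lemma is_minimizer_minimizer: "is_minimizer d f (minimizer d f)"
  unfolding minimizer_def using minimizer_exists minimizer_unique
  by (intro theI'[of "is_minimizer d f"]) blast

text \<open>The class constants may be weaker than those of \<open>f\<close>, so an objective with
  its own curvature serves every smaller \<open>\<mu>'\<close>.\<close>

lemma in_Fclass:
  assumes "\<mu>' \<le> \<mu>" "\<beta> \<le> \<beta>'" "\<And>x. is_minimizer d f x \<Longrightarrow> nrm d x \<le> R / 2"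
  shows "f \<in> Fclass d R \<mu>' \<beta>'"
proof -
  have "f x + dot d (G x) (vdiff d y x) + \<mu>' / 2 * (nrm d (vdiff d y x))\<^sup>2 \<le> f y"
    if "x \<in> Rd d" "y \<in> Rd d" for x y
    using lower[OF that] mult_right_mono[of "\<mu>' / 2" "\<mu> / 2" "(nrm d (vdiff d y x))\<^sup>2"] assms(1)
    by simp
  moreover have "nrm d (vdiff d (G x) (G y)) \<le> \<beta>' * nrm d (vdiff d x y)"
    if "x \<in> Rd d" "y \<in> Rd d" for x y
    using lipschitz[OF that] mult_right_mono[OF assms(2), of "nrm d (vdiff d x y)"]
    by (simp add: L2_set_nonneg)
  moreover have "minimizer d f \<in> B2 d (R / 2)"
    using is_minimizer_minimizer assms(3) by (auto simp: B2_def is_minimizer_def)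
  ultimately show ?thesis
    unfolding Fclass_def
    using has_gradient_G continuous_on_G minimizer_exists minimizer_unique by blast
qed

end

section \<open>The resisting oracle\<close>

text \<open>Consecutive entries are offset by \<open>2 * s\<close>: one \<open>s\<close> for the range of the smoothing, the other
  for the inner products \<open>dot d (V j) x\<close> of a direction not yet revealed, which are only known to be
  at most \<open>s\<close>.\<close>

definition hard :: "nat \<Rightarrow> nat \<Rightarrow> real \<Rightarrow> real \<Rightarrow> real \<Rightarrow> (nat \<Rightarrow> nat \<Rightarrow> real) \<Rightarrow> (nat \<Rightarrow> real) \<Rightarrow> real" where
  "hard d k s \<alpha> \<mu> V x =
     \<alpha> * smax k s (\<lambda>j. dot d (V j) x - real j * (2 * s)) + \<mu> / 2 * dot d x x"

definition hard_grad ::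
  "nat \<Rightarrow> nat \<Rightarrow> real \<Rightarrow> real \<Rightarrow> real \<Rightarrow> (nat \<Rightarrow> nat \<Rightarrow> real) \<Rightarrow> (nat \<Rightarrow> real) \<Rightarrow> nat \<Rightarrow> real" where
  "hard_grad d k s \<alpha> \<mu> V x = (\<lambda>i\<in>{..<d}.
     \<alpha> * (\<Sum>j<k. weights k s (\<lambda>j. dot d (V j) x - real j * (2 * s)) j * V j i) + \<mu> * x i)"

text \<open>By Bessel's inequality the entries depend on \<open>x\<close> in a nonexpansive way, so
  \<open>smax\<close> stays \<open>1 / s\<close>-smooth as a function of \<open>x\<close>.\<close>

lemma strongly_convex_smooth_hard:
  assumes V: "orthonormal d k V" and "0 < k" "0 < s" "0 < \<alpha>" "0 < \<mu>"
  shows "strongly_convex_smooth d (hard d k s \<alpha> \<mu> V) (hard_grad d k s \<alpha> \<mu> V) \<mu> (\<alpha> / s + \<mu>) (\<alpha> / s + \<mu>)"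
proof
  let ?a = "\<lambda>x j. dot d (V j) x - real j * (2 * s)"
  let ?w = "\<lambda>x. weights k s (?a x)"
  have entries: "(\<Sum>j<k. (?a y j - ?a x j)\<^sup>2) \<le> (nrm d (vdiff d y x))\<^sup>2" for x y
    using bessel[OF V, of "vdiff d y x"] by (simp add: nrm_sq dot_vdiff_right)
  have linear: "dot d (hard_grad d k s \<alpha> \<mu> V x) (vdiff d y x)
      = \<alpha> * (\<Sum>j<k. ?w x j * (?a y j - ?a x j)) + \<mu> * (dot d x y - dot d x x)" for x y
    unfolding hard_grad_def dot_restrict_left dot_add_left dot_scale_left dot_sum_left dot_vdiff_right
    by (simp add: right_diff_distrib sum_subtractf)
  have quadratic: "\<mu> / 2 * dot d y y = \<mu> / 2 * dot d x x + \<mu> * (dot d x y - dot d x x)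
      + \<mu> / 2 * (nrm d (vdiff d y x))\<^sup>2" for x y
    by (simp add: nrm_sq dot_vdiff_left dot_vdiff_right dot_commute[of d y x] algebra_simps)
  show "0 < \<mu>" by fact
  show "hard_grad d k s \<alpha> \<mu> V x \<in> Rd d" for x
    by (simp add: hard_grad_def Rd_def)
  show "hard d k s \<alpha> \<mu> V x + dot d (hard_grad d k s \<alpha> \<mu> V x) (vdiff d y x)
      + \<mu> / 2 * (nrm d (vdiff d y x))\<^sup>2 \<le> hard d k s \<alpha> \<mu> V y" for x y
  proof -
    have "0 \<le> s / 2 * (\<Sum>j<k. (?w y j - ?w x j)\<^sup>2)"
      using assms by (intro mult_nonneg_nonneg sum_nonneg) auto
    then have "smax k s (?a x) + (\<Sum>j<k. ?w x j * (?a y j - ?a x j)) \<le> smax k s (?a y)"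
      using smax_subgradient[OF \<open>0 < k\<close> \<open>0 < s\<close>, of "?a x" "?a y"] by linarith
    then have "\<alpha> * (smax k s (?a x) + (\<Sum>j<k. ?w x j * (?a y j - ?a x j))) \<le> \<alpha> * smax k s (?a y)"
      using assms by (intro mult_left_mono) auto
    then show ?thesis
      using quadratic[of y x] unfolding linear hard_def distrib_left by linarith
  qed
  show "hard d k s \<alpha> \<mu> V y \<le> hard d k s \<alpha> \<mu> V x + dot d (hard_grad d k s \<alpha> \<mu> V x) (vdiff d y x)
      + (\<alpha> / s + \<mu>) / 2 * (nrm d (vdiff d y x))\<^sup>2" for x y
  proof -
    have "(\<Sum>j<k. (?a y j - ?a x j)\<^sup>2) / (2 * s) \<le> (nrm d (vdiff d y x))\<^sup>2 / (2 * s)"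
      using entries[of y x] assms by (intro divide_right_mono) auto
    then have "smax k s (?a y) \<le> smax k s (?a x) + (\<Sum>j<k. ?w x j * (?a y j - ?a x j))
        + (nrm d (vdiff d y x))\<^sup>2 / (2 * s)"
      using smax_upper[OF \<open>0 < k\<close> \<open>0 < s\<close>, of "?a y" "?a x"] by linarith
    then have "\<alpha> * smax k s (?a y) \<le> \<alpha> * (smax k s (?a x) + (\<Sum>j<k. ?w x j * (?a y j - ?a x j))
        + (nrm d (vdiff d y x))\<^sup>2 / (2 * s))"
      using assms by (intro mult_left_mono) auto
    also have "\<dots> = \<alpha> * smax k s (?a x) + \<alpha> * (\<Sum>j<k. ?w x j * (?a y j - ?a x j))
        + \<alpha> / s / 2 * (nrm d (vdiff d y x))\<^sup>2"
      by (simp add: distrib_left)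
    finally show ?thesis
      using quadratic[of y x] unfolding linear hard_def add_divide_distrib distrib_right by linarith
  qed
  show "nrm d (vdiff d (hard_grad d k s \<alpha> \<mu> V x) (hard_grad d k s \<alpha> \<mu> V y))
      \<le> (\<alpha> / s + \<mu>) * nrm d (vdiff d x y)" for x y
  proof -
    define z where "z = vdiff d x y"
    \<comment> \<open>Up to the factor \<open>\<alpha>\<close>, the difference of the gradients of
      the \<open>smax\<close> parts; its norm is that of the weight difference, as \<open>V\<close>
      is orthonormal.\<close>
    define P where "P i = (\<Sum>j<k. (?w x j - ?w y j) * V j i)" for i
    have PP: "dot d P P = (\<Sum>j<k. (?w x j - ?w y j)\<^sup>2)"
      unfolding P_def by (rule dot_combination_self[OF V])
    have "s\<^sup>2 * dot d P P \<le> (nrm d z)\<^sup>2"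
      unfolding PP z_def
      using weights_lipschitz[OF \<open>0 < k\<close> \<open>0 < s\<close>] entries by (rule order_trans)
    then have "dot d P P \<le> (nrm d z / s)\<^sup>2"
      using assms by (simp add: power_divide field_simps)
    then have P: "nrm d P \<le> nrm d z / s"
      using assms nrm_le_iff[of "nrm d z / s" P d] by (simp add: L2_set_nonneg)
    have "nrm d (vdiff d (hard_grad d k s \<alpha> \<mu> V x) (hard_grad d k s \<alpha> \<mu> V y))
        = nrm d (\<lambda>i. \<alpha> * P i + \<mu> * z i)"
      unfolding hard_grad_def vdiff_def z_def P_def
      by (intro L2_set_cong) (auto simp: left_diff_distrib sum_subtractf algebra_simps)
    also have "\<dots> \<le> nrm d (\<lambda>i. \<alpha> * P i) + nrm d (\<lambda>i. \<mu> * z i)"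
      by (rule L2_set_triangle_ineq)
    also have "\<dots> = \<alpha> * nrm d P + \<mu> * nrm d z"
      using assms by (simp add: L2_set_right_distrib)
    also have "\<dots> \<le> \<alpha> * (nrm d z / s) + \<mu> * nrm d z"
      using P assms by (intro add_right_mono mult_left_mono) auto
    finally show ?thesis by (simp add: z_def algebra_simps)
  qed
qed

text \<open>In the second alternative entry \<open>j\<close> lies at least \<open>s\<close> below
  entry \<open>l\<close>, for both families: the offsets differ by at least \<open>2 * s\<close> and
  the inner product makes up at most \<open>s\<close>. Hence it has no influence.\<close>

lemma hard_eqI:
  assumes "0 < k" "0 < s"
    and "\<And>j. j < k \<Longrightarrow> dot d (V j) x = dot d (V' j) x \<or>
      (\<exists>l<j. dot d (V l) x = 0 \<and> dot d (V' l) x = 0 \<and> dot d (V j) x \<le> s \<and> dot d (V' j) x \<le> s)"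
  shows "hard d k s \<alpha> \<mu> V x = hard d k s \<alpha> \<mu> V' x"
proof -
  let ?a = "\<lambda>V j. dot d (V j) x - real j * (2 * s)"
  have le: "smax k s (?a V) \<le> smax k s (?a V')"
    if local: "\<And>j. j < k \<Longrightarrow> dot d (V j) x = dot d (V' j) x \<or>
      (\<exists>l<j. dot d (V l) x = 0 \<and> dot d (V j) x \<le> s)" for V V'
  proof (rule smax_local_le[OF assms(1,2)])
    fix j assume j: "j < k"
    consider "dot d (V j) x = dot d (V' j) x" | l where "l < j" "dot d (V l) x = 0" "dot d (V j) x \<le> s"
      using local[OF j] by blast
    then show "?a V j = ?a V' j \<or> (\<exists>l<k. ?a V j \<le> ?a V l - s)"
    proof cases
      case 2
      then have "(real l + 1) * (2 * s) \<le> real j * (2 * s)"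
        using assms by (intro mult_right_mono) auto
      then have "?a V j \<le> ?a V l - s"
        using 2 by (simp add: algebra_simps)
      then show ?thesis using 2 j by (intro disjI2 exI[of _ l]) auto
    qed simp
  qed
  have "smax k s (?a V) = smax k s (?a V')"
  proof (rule antisym)
    show "smax k s (?a V) \<le> smax k s (?a V')" by (rule le) (use assms(3) in blast)
    show "smax k s (?a V') \<le> smax k s (?a V)" by (rule le) (use assms(3) in metis)
  qed
  then show ?thesis by (simp add: hard_def)
qed

text \<open>Here \<open>X F t\<close> is the query with index \<open>t\<close> on the objective \<open>F\<close>, and \<open>t div p\<close> is its phase.\<close>

lemma resisting_oracle:
  fixes X :: "((nat \<Rightarrow> real) \<Rightarrow> real) \<Rightarrow> nat \<Rightarrow> nat \<Rightarrow> real"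
  assumes causal: "\<And>F F' t. (\<And>u. u < t \<Longrightarrow> F (X F u) = F' (X F u)) \<Longrightarrow> X F t = X F' t"
    and ball: "\<And>F t. nrm d (X F t) \<le> R"
    and pos: "0 < k" "0 < s" "0 < R" "0 < m" "0 < p"
    and dim: "k + p + m \<le> d"
    and large: "2 * ln (2 * real (k * p)) * R\<^sup>2 \<le> s\<^sup>2 * real m"
    and i: "i \<le> k"
  shows "\<exists>V. (\<forall>j\<ge>i. V j = (\<lambda>_. 0)) \<and> orthonormal d i V \<and>
    (\<forall>t<i * p. dot d (V (t div p)) (X (hard d k s \<alpha> \<mu> V) t) = 0)"
  using i
proof (induction i)
  case 0
  show ?case by (rule exI[of _ "\<lambda>_ _. 0"]) (simp add: orthonormal_def)
next
  case (Suc i)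
  then obtain V where V0: "\<And>j. i \<le> j \<Longrightarrow> V j = (\<lambda>_. 0)" and V: "orthonormal d i V"
    and VX: "\<And>t. t < i * p \<Longrightarrow> dot d (V (t div p)) (X (hard d k s \<alpha> \<mu> V) t) = 0"
    by auto
  define x where "x = X (hard d k s \<alpha> \<mu> V)"
  \<comment> \<open>Orthogonality is exact for the \<open>i\<close> earlier directions and the
    \<open>p\<close> queries of phase \<open>i\<close>, and only approximate for the
    \<open>i * p\<close> earlier queries.\<close>
  define a where "a j = (if j < i then V j else x (i * p + (j - i)))" for j
  \<comment> \<open>For \<open>i = 0\<close> there is no earlier query and \<open>ln 0 = 0\<close>
    settles the bound.\<close>
  have "2 * ln (2 * real (i * p)) * R\<^sup>2 \<le> s\<^sup>2 * real m"
  proof (cases "i = 0")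
    case False
    then have "1 \<le> i * p" "i * p \<le> k * p" using pos Suc.prems by auto
    then have "ln (2 * real (i * p)) \<le> ln (2 * real (k * p))"
      by (subst ln_le_cancel_iff) (auto simp del: of_nat_mult)
    then show ?thesis
      using large by (smt (verit) mult_right_mono zero_le_power2)
  qed simp
  then obtain v where v: "dot d v v = 1" "\<And>j. j < i + p \<Longrightarrow> dot d v (a j) = 0"
    "\<And>t. t < i * p \<Longrightarrow> \<bar>dot d v (x t)\<bar> \<le> s"
    using nearly_orthogonal_unit_vector[of "i + p" m d R s "i * p" x a] pos dim Suc.prems ball
    unfolding x_def by auto
  have vV: "dot d v (V j) = 0" if "j < i" for j
    using v(2)[of j] that by (simp add: a_def)
  have vx: "dot d v (x t) = 0" if "i * p \<le> t" "t < Suc i * p" for t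
  proof -
    have "dot d v (x (i * p + r)) = 0" if "r < p" for r
      using v(2)[of "i + r"] that by (simp add: a_def)
    moreover have "t - i * p < p" using that by auto
    ultimately have "dot d v (x (i * p + (t - i * p))) = 0" by blast
    then show ?thesis using that(1) by simp
  qed
  define V' where "V' = V(i := v)"
  have zero: "dot d (\<lambda>_. 0) y = 0" for y by (simp add: dot_def)
  \<comment> \<open>Only entry \<open>i\<close> changes. Queries of phase \<open>i\<close> are
    orthogonal to \<open>v\<close>; an earlier query is orthogonal to the direction of its own
    phase, which hides entry \<open>i\<close>.\<close>
  have agree: "hard d k s \<alpha> \<mu> V (x t) = hard d k s \<alpha> \<mu> V' (x t)" if t: "t < Suc i * p" for t
  proof (rule hard_eqI[OF pos(1,2)])
    fix j
    show "dot d (V j) (x t) = dot d (V' j) (x t) \<or> (\<exists>l<j. dot d (V l) (x t) = 0 \<and>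
      dot d (V' l) (x t) = 0 \<and> dot d (V j) (x t) \<le> s \<and> dot d (V' j) (x t) \<le> s)"
    proof (cases "j = i")
      case True
      show ?thesis
      proof (cases "t < i * p")
        case early: True
        then have "t div p < i" by (simp add: less_mult_imp_div_less)
        moreover have "dot d (V (t div p)) (x t) = 0"
          using VX[OF early] by (simp add: x_def)
        ultimately show ?thesis
          using v(3)[OF early] pos True
          by (intro disjI2 exI[of _ "t div p"]) (auto simp: V'_def V0 zero)
      next
        case False
        then show ?thesis using vx[of t] t True by (simp add: V'_def V0 zero)
      qed
    qed (simp add: V'_def)
  qed
  \<comment> \<open>Equal answers force equal queries, so the points used to choose \<open>v\<close>
    are also the queries on the new function.\<close>
  have same: "X (hard d k s \<alpha> \<mu> V') t = x t" if "t < Suc i * p" for t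
    unfolding x_def by (rule causal[symmetric]) (use agree that in \<open>simp add: x_def\<close>)
  have "dot d (V' (t div p)) (x t) = 0" if t: "t < Suc i * p" for t
  proof (cases "t < i * p")
    case True
    then have "t div p \<noteq> i" using less_mult_imp_div_less[OF True] by simp
    then show ?thesis using VX[OF True] by (simp add: V'_def x_def)
  next
    case False
    then have "t div p = i" using t by (intro div_nat_eqI) (auto simp: mult.commute)
    then show ?thesis using vx[of t] False t by (simp add: V'_def)
  qed
  moreover have "orthonormal d (Suc i) V'"
    using V v(1) vV unfolding orthonormal_def V'_def
    by (auto simp: less_Suc_eq dot_commute[of d "V j" v for j])
  moreover have "V' j = (\<lambda>_. 0)" if "Suc i \<le> j" for j
    using that V0[of j] by (simp add: V'_def)
  ultimately show ?case
    using same by (intro exI[of _ V']) simp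
qed

text \<open>Calibration of the adversary: all \<open>k\<close> directions help to lower the minimum,
  while the last point is orthogonal to one of them.\<close>

lemma hard_objective:
  fixes X :: "((nat \<Rightarrow> real) \<Rightarrow> real) \<Rightarrow> nat \<Rightarrow> nat \<Rightarrow> real"
  assumes causal: "\<And>F F' t. (\<And>u. u < t \<Longrightarrow> F (X F u) = F' (X F u)) \<Longrightarrow> X F t = X F' t"
    and ball: "\<And>F t. nrm d (X F t) \<le> R"
    and pos: "0 < k" "0 < R" "0 < m" "0 < p" "0 < \<beta>"
    and dim: "k + p + m \<le> d"
    and large: "8192 * real k ^ 3 * ln (2 * real (k * p)) \<le> real m"
    and \<mu>: "\<mu> \<le> \<beta> / (9 * (real k)\<^sup>2)"
  shows "\<exists>F\<in>Fclass d R \<mu> \<beta>.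
    \<beta> * R\<^sup>2 / (2304 * (real k)\<^sup>2) \<le> F (X F (k * p - 1)) - F (minimizer d F)"
proof -
  define r where "r = sqrt (real k)"
  have r: "0 < r" "r\<^sup>2 = real k" using pos by (auto simp: r_def)
  \<comment> \<open>The total offset \<open>2 * k * s\<close> becomes a quarter of
    \<open>R / (8 * r)\<close>, the drop achieved at \<open>z\<close> below.\<close>
  define s where "s = R / (64 * r ^ 3)"
  \<comment> \<open>The factor 9 makes room for
    \<open>\<alpha> / s + \<nu> = (8 * k ^ 2 + 1) * \<nu>\<close> below
    \<open>\<beta>\<close>.\<close>
  define \<nu> where "\<nu> = \<beta> / (9 * (real k)\<^sup>2)"
  \<comment> \<open>Then \<open>- \<alpha> * n / r + \<nu> / 2 * n ^ 2\<close> is minimal at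
    \<open>n = R / 8\<close>, the norm of \<open>z\<close>.\<close>
  define \<alpha> where "\<alpha> = \<nu> * R * r / 8"
  have spos: "0 < s" "0 < \<nu>" "0 < \<alpha>" using pos r by (auto simp: s_def \<nu>_def \<alpha>_def)
  have "s\<^sup>2 * real m = R\<^sup>2 * real m / (4096 * real k ^ 3)"
    by (simp add: s_def power_divide power_mult_distrib r(2)[symmetric] flip: power_mult)
  moreover have "2 * ln (2 * real (k * p)) * R\<^sup>2
      = R\<^sup>2 * (8192 * real k ^ 3 * ln (2 * real (k * p))) / (4096 * real k ^ 3)"
    using pos by simp
  moreover have "\<dots> \<le> R\<^sup>2 * real m / (4096 * real k ^ 3)"
    using large by (intro divide_right_mono mult_left_mono) auto
  ultimately have "2 * ln (2 * real (k * p)) * R\<^sup>2 \<le> s\<^sup>2 * real m"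
    by linarith
  from resisting_oracle[where X = X and \<alpha> = \<alpha> and \<mu> = \<nu>, OF causal ball \<open>0 < k\<close> \<open>0 < s\<close>
      \<open>0 < R\<close> \<open>0 < m\<close> \<open>0 < p\<close> dim this order_refl]
  obtain V where V: "orthonormal d k V"
    and VX: "\<And>t. t < k * p \<Longrightarrow> dot d (V (t div p)) (X (hard d k s \<alpha> \<nu> V) t) = 0"
    by blast
  define F where "F = hard d k s \<alpha> \<nu> V"
  let ?a = "\<lambda>x j. dot d (V j) x - real j * (2 * s)"
  have F: "F x = \<alpha> * smax k s (?a x) + \<nu> / 2 * (nrm d x)\<^sup>2" for x
    by (simp add: F_def hard_def nrm_sq)
  interpret strongly_convex_smooth d F "hard_grad d k s \<alpha> \<nu> V" \<nu> "\<alpha> / s + \<nu>" "\<alpha> / s + \<nu>"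
    unfolding F_def by (rule strongly_convex_smooth_hard[OF V \<open>0 < k\<close> spos(1,3,2)])
  have r4: "r ^ 4 = (real k)\<^sup>2"
    by (simp add: r(2)[symmetric] flip: power_mult)
  have "\<alpha> / s = 8 * \<nu> * r ^ 4"
    using pos r(1) by (simp add: \<alpha>_def s_def field_simps eval_nat_numeral)
  then have "\<alpha> / s + \<nu> = (8 * (real k)\<^sup>2 + 1) * \<nu>"
    by (simp add: r4 algebra_simps)
  also have "\<dots> \<le> (9 * (real k)\<^sup>2) * \<nu>"
    using pos spos one_le_power[of "real k" 2] by (intro mult_right_mono) auto
  also have "\<dots> = \<beta>" using pos by (simp add: \<nu>_def)
  finally have \<beta>: "\<alpha> / s + \<nu> \<le> \<beta>" .
  define W where "W i = (\<Sum>j<k. 1 * V j i)" for i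
  have WW: "dot d W W = r\<^sup>2"
    unfolding W_def dot_combination_self[OF V] by (simp add: r)
  then have nW: "nrm d W \<le> r" using r by (simp add: nrm_le_iff)
  \<comment> \<open>The minimizer if offsets and smoothing are ignored: all inner products are
    lowered equally.\<close>
  define z where "z = (\<lambda>i\<in>{..<d}. - (R / (8 * r)) * W i)"
  have zR: "z \<in> Rd d" by (simp add: z_def Rd_def)
  have Vz: "dot d (V j) z = - (R / (8 * r))" if "j < k" for j
    using dot_combination[OF V that, of "\<lambda>_. 1"] dot_scale_left[of d "- (R / (8 * r))" W "V j"]
    unfolding W_def z_def by (simp add: dot_commute[of d "V j"])
  have "dot d z z = (R / (8 * r)) * (R / (8 * r)) * dot d W W"
    unfolding z_def dot_restrict_left dot_restrict_right dot_scale_left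
      dot_commute[of d W "\<lambda>i. - (R / (8 * r)) * W i"]
    by simp
  then have nz: "(nrm d z)\<^sup>2 = R\<^sup>2 / 64"
    using r(1) unfolding nrm_sq WW by (simp add: power2_eq_square)
  have "smax k s (?a z) \<le> - (R / (8 * r))"
    using spos by (intro smax_le[OF \<open>0 < k\<close> \<open>0 < s\<close>]) (simp add: Vz)
  then have "\<alpha> * smax k s (?a z) \<le> \<alpha> * - (R / (8 * r))"
    using spos by (intro mult_left_mono) auto
  also have "\<dots> = - \<nu> * R\<^sup>2 / 64"
    using r(1) by (simp add: \<alpha>_def power2_eq_square)
  finally have Fz: "F z \<le> - \<nu> * R\<^sup>2 / 128"
    unfolding F nz by simp
  have \<alpha>ks: "\<alpha> * (real k * (2 * s)) = \<nu> * R\<^sup>2 / 256"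
    using r(1) by (simp add: \<alpha>_def s_def r(2)[symmetric] field_simps eval_nat_numeral)
  have "F \<in> Fclass d R \<mu> \<beta>"
  proof (rule in_Fclass[OF _ \<beta>])
    show "\<mu> \<le> \<nu>" using \<mu> by (simp add: \<nu>_def)
    fix x assume "is_minimizer d F x"
    then have "F x \<le> F z" using zR by (simp add: is_minimizer_def)
    also have "\<dots> \<le> 0" using Fz spos by (simp add: zero_le_mult_iff order_trans)
    finally have Fx: "F x \<le> 0" .
    \<comment> \<open>The average of the entries bounds \<open>smax\<close> from below, so a
      nonpositive value leaves a quadratic inequality for the norm.\<close>
    let ?n = "nrm d x"
    have "- (r * ?n) \<le> dot d W x"
      using dot_le_nrm[of d W x] mult_right_mono[OF nW, of ?n] by (simp add: L2_set_nonneg)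
    also have "\<dots> = (\<Sum>j<k. dot d (V j) x)"
      unfolding W_def dot_sum_left by simp
    finally have Vx: "- (r * ?n) \<le> (\<Sum>j<k. dot d (V j) x)" .
    have "(\<Sum>j<k. real j * (2 * s)) \<le> (\<Sum>j<k. (real k - 1) * (2 * s))"
      using spos by (intro sum_mono mult_right_mono) auto
    then have "- (r * ?n) - real k * ((real k - 1) * (2 * s)) \<le> (\<Sum>j<k. ?a x j)"
      using Vx by (simp add: sum_subtractf)
    then have "(- (r * ?n) - real k * ((real k - 1) * (2 * s))) / real k \<le> (\<Sum>j<k. ?a x j) / real k"
      by (intro divide_right_mono) auto
    moreover have "(- (r * ?n) - real k * ((real k - 1) * (2 * s))) / real k
        = - (?n / r) - (real k - 1) * (2 * s)"
      using pos r by (simp add: diff_divide_distrib power2_eq_square r(2)[symmetric])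
    moreover have "s / (2 * real k) \<le> s"
      using pos spos by (simp add: divide_le_eq)
    ultimately have "- (?n / r) - real k * (2 * s) \<le> smax k s (?a x)"
      using smax_ge_average[OF \<open>0 < k\<close> \<open>0 < s\<close>, of "?a x"] spos by (simp add: left_diff_distrib)
    then have "\<alpha> * (- (?n / r) - real k * (2 * s)) \<le> \<alpha> * smax k s (?a x)"
      using spos by (intro mult_left_mono) auto
    moreover have "\<alpha> * (- (?n / r) - real k * (2 * s)) = - (\<nu> * R * ?n / 8) - \<nu> * R\<^sup>2 / 256"
      unfolding right_diff_distrib \<alpha>ks using r(1) by (simp add: \<alpha>_def)
    ultimately have "\<nu> * (?n\<^sup>2 / 2 - R * ?n / 8 - R\<^sup>2 / 256) \<le> 0"
      using Fx unfolding F by (simp add: algebra_simps)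
    then have "?n\<^sup>2 / 2 - R * ?n / 8 - R\<^sup>2 / 256 \<le> 0"
      using spos by (simp add: mult_le_0_iff)
    then have *: "128 * ?n\<^sup>2 \<le> 32 * R * ?n + R\<^sup>2" by simp
    show "?n \<le> R / 2"
    proof (rule ccontr)
      assume "\<not> ?n \<le> R / 2"
      \<comment> \<open>The right-hand side of \<open>*\<close> would then be less than
        \<open>68 * ?n ^ 2\<close>.\<close>
      then have "R * R < R * (2 * ?n)" "R * ?n \<le> 2 * ?n * ?n"
        using pos by (auto intro: mult_right_mono mult_strict_left_mono)
      then show False using * zero_le_square[of ?n] by (simp add: power2_eq_square)
    qed
  qed
  moreover have "\<beta> * R\<^sup>2 / (2304 * (real k)\<^sup>2) \<le> F (X F (k * p - 1)) - F (minimizer d F)"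
  proof -
    define x where "x = X F (k * p - 1)"
    \<comment> \<open>The last point belongs to the last phase; the entry of that phase's direction
      alone keeps the value up.\<close>
    have "(k * p - 1) div p = k - 1"
      using pos by (intro div_nat_eqI) (auto simp: algebra_simps diff_mult_distrib)
    then have Vx: "dot d (V (k - 1)) x = 0"
      using VX[of "k * p - 1"] pos by (simp add: x_def F_def)
    have "- (real k * (2 * s)) \<le> ?a x (k - 1) - s / 2"
      unfolding Vx using pos spos by (simp add: of_nat_diff algebra_simps)
    also have "\<dots> \<le> smax k s (?a x)"
      using pos by (intro smax_ge_entry[OF \<open>0 < k\<close> \<open>0 < s\<close>]) simp
    finally have "\<alpha> * - (real k * (2 * s)) \<le> \<alpha> * smax k s (?a x)"
      using spos by (intro mult_left_mono) auto
    moreover have "0 \<le> \<nu> / 2 * (nrm d x)\<^sup>2" using spos by simp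
    ultimately have "- (\<nu> * R\<^sup>2 / 256) \<le> F x"
      unfolding F using \<alpha>ks by simp
    moreover have "F (minimizer d F) \<le> F z"
      using is_minimizer_minimizer zR by (simp add: is_minimizer_def)
    ultimately have "\<nu> * R\<^sup>2 / 256 \<le> F x - F (minimizer d F)"
      using Fz by linarith
    then show ?thesis by (simp add: \<nu>_def x_def mult.commute)
  qed
  ultimately show ?thesis by blast
qed

section \<open>The lower bound\<close>

text \<open>At points orthogonal to the hidden centre \<open>a\<close>, the values of
  \<open>F\<close> are those of \<open>H\<close>, which depends only on the norm of
  \<open>a\<close>. So \<open>a\<close> can be chosen after the queries on \<open>H\<close>.\<close>

lemma sphere_objective:
  fixes X :: "((nat \<Rightarrow> real) \<Rightarrow> real) \<Rightarrow> nat \<Rightarrow> nat \<Rightarrow> real"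
  assumes causal: "\<And>F F' t. (\<And>u. u < t \<Longrightarrow> F (X F u) = F' (X F u)) \<Longrightarrow> X F t = X F' t"
    and pos: "0 < R" "0 < \<beta>" "\<mu> \<le> \<beta>" "Suc t < d"
  shows "\<exists>F\<in>Fclass d R \<mu> \<beta>. \<beta> * R\<^sup>2 / 8 \<le> F (X F t) - F (minimizer d F)"
proof -
  define H where "H x = \<beta> / 2 * (dot d x x + R\<^sup>2 / 4)" for x
  \<comment> \<open>The point with index \<open>t\<close> is included, so that its value is bounded
    below as well.\<close>
  obtain v where v: "dot d v v = 1" "\<And>u. u < Suc t \<Longrightarrow> dot d v (X H u) = 0"
    using unit_vector_orthogonal[OF assms(5), of "X H"] by blast
  define a where "a = (\<lambda>i\<in>{..<d}. R / 2 * v i)"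
  have aR: "a \<in> Rd d" by (simp add: a_def Rd_def)
  have aa: "dot d a a = R\<^sup>2 / 4"
    unfolding a_def dot_restrict_left dot_restrict_right dot_scale_left
      dot_commute[of d v "\<lambda>i. R / 2 * v i"]
    by (simp add: v(1) power2_eq_square)
  have ax: "dot d a (X H u) = 0" if "u < Suc t" for u
    using v(2)[OF that] unfolding a_def dot_restrict_left dot_scale_left by simp
  define F where "F x = \<beta> / 2 * (nrm d (vdiff d x a))\<^sup>2" for x
  have F: "F x = \<beta> / 2 * (dot d x x - 2 * dot d a x + R\<^sup>2 / 4)" for x
    by (simp add: F_def nrm_sq dot_vdiff_left dot_vdiff_right dot_commute[of d x a] aa)
  define G where "G x = (\<lambda>i\<in>{..<d}. \<beta> * vdiff d x a i)" for x
  have quadratic: "F y = F x + dot d (G x) (vdiff d y x) + \<beta> / 2 * (nrm d (vdiff d y x))\<^sup>2" for x y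
  proof -
    have "dot d (G x) (vdiff d y x) = \<beta> * (dot d x y - dot d a y - dot d x x + dot d a x)"
      unfolding G_def dot_restrict_left dot_scale_left dot_vdiff_left dot_vdiff_right
      by (simp add: algebra_simps)
    then show ?thesis
      by (simp add: F nrm_sq dot_vdiff_left dot_vdiff_right dot_commute[of d y x] algebra_simps)
  qed
  interpret strongly_convex_smooth d F G \<beta> \<beta> \<beta>
  proof
    show "G x \<in> Rd d" for x by (simp add: G_def Rd_def)
    show "nrm d (vdiff d (G x) (G y)) \<le> \<beta> * nrm d (vdiff d x y)" for x y
    proof -
      have "nrm d (vdiff d (G x) (G y)) = nrm d (\<lambda>i. \<beta> * vdiff d x y i)"
        by (intro L2_set_cong) (auto simp: G_def vdiff_def algebra_simps)
      then show ?thesis using pos by (simp add: L2_set_right_distrib)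
    qed
  qed (use pos quadratic in \<open>simp_all\<close>)
  have Fa: "F a = 0" by (simp add: F_def vdiff_def L2_set_def)
  have "F \<in> Fclass d R \<mu> \<beta>"
  proof (rule in_Fclass)
    fix x assume "is_minimizer d F x"
    then have x: "x \<in> Rd d" "F x \<le> 0"
      using aR Fa by (auto simp: is_minimizer_def)
    then have "nrm d (vdiff d x a) = 0"
      using pos by (simp add: F_def mult_le_0_iff)
    then have "x = a" by (rule vdiff_eq_0D[OF x(1) aR])
    then show "nrm d x \<le> R / 2"
      using pos aa nrm_le_iff[of "R / 2" a d] by (simp add: power_divide)
  qed (use pos in auto)
  have "X F t = X H t"
    by (rule causal[symmetric]) (use ax in \<open>simp add: F H_def\<close>)
  then have "F (X F t) = \<beta> / 2 * (dot d (X H t) (X H t) + R\<^sup>2 / 4)"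
    using F[of "X H t"] ax[of t] by simp
  moreover have "\<beta> / 2 * (R\<^sup>2 / 4) \<le> \<beta> / 2 * (dot d (X H t) (X H t) + R\<^sup>2 / 4)"
    using pos dot_self_nonneg[of d "X H t"] by (intro mult_left_mono) auto
  ultimately have "\<beta> * R\<^sup>2 / 8 \<le> F (X F t)" by simp
  have "F (minimizer d F) \<le> F a"
    using is_minimizer_minimizer aR unfolding is_minimizer_def by blast
  then have "\<beta> * R\<^sup>2 / 8 \<le> F (X F t) - F (minimizer d F)"
    using \<open>\<beta> * R\<^sup>2 / 8 \<le> F (X F t)\<close> Fa by linarith
  then show ?thesis using \<open>F \<in> Fclass d R \<mu> \<beta>\<close> by blast
qed

section \<open>From algorithms to causal sequences of points\<close>

lemma run_cong:
  assumes "\<And>u. u < t \<Longrightarrow> F (Q u (run Q F u)) = F' (Q u (run Q F u))"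
  shows "run Q F t = run Q F' t"
  using assms
proof (induction t)
  case (Suc t)
  then have "run Q F t = run Q F' t" by simp
  then show ?case using Suc.prems[of t] by (simp add: Let_def)
qed simp

lemma space_Xspace: "space (Xspace d R) = B2 d R"
  by (auto simp: Xspace_def space_restrict_space space_PiM B2_def Rd_def)

lemma space_Hspace: "space (Hspace d R t) = PiE {..<t} (\<lambda>_. B2 d R \<times> UNIV)"
  by (simp add: Hspace_def space_PiM space_pair_measure space_Xspace)

lemma run_in_space:
  assumes "algorithm d R T Q Qout" "t \<le> T"
  shows "run Q F t \<in> space (Hspace d R t)"
  using assms(2)
proof (induction t)
  case 0
  then show ?case by (simp add: space_Hspace)
next
  case (Suc t)
  then have run: "run Q F t \<in> space (Hspace d R t)" by simp
  moreover have "Q t \<in> Hspace d R t \<rightarrow>\<^sub>M Xspace d R"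
    using assms(1) Suc.prems by (simp add: algorithm_def)
  ultimately have "Q t (run Q F t) \<in> B2 d R"
    unfolding space_Xspace[symmetric] by (rule measurable_space[rotated])
  then show ?case
    using run by (auto simp: space_Hspace Let_def PiE_iff extensional_def less_Suc_eq)
qed

text \<open>An algorithm becomes a causal sequence in the ball whose term \<open>N - 1\<close> is
  its output whenever \<open>T < N\<close>; a bad objective for that term rules the algorithm
  out.\<close>

lemma Ncomp_ge:
  assumes hard: "\<And>X. (\<And>F F' t. (\<And>u. u < t \<Longrightarrow> F (X F u) = F' (X F u)) \<Longrightarrow> X F t = X F' t) \<Longrightarrow>
      (\<And>F t. nrm d (X F t) \<le> R) \<Longrightarrow>
      \<exists>F\<in>Fclass d R \<mu> \<beta>. \<epsilon> < F (X F (N - 1)) - F (minimizer d F)"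
  shows "enat N \<le> Ncomp \<epsilon> d R \<mu> \<beta>"
  unfolding Ncomp_def
proof (rule INF_greatest)
  fix T assume "T \<in> {T. \<exists>Q Qout. algorithm d R T Q Qout \<and>
    (SUP f\<in>Fclass d R \<mu> \<beta>. ereal (f (final_point T Q Qout f) - f (minimizer d f))) \<le> ereal \<epsilon>}"
  then obtain Q Qout where alg: "algorithm d R T Q Qout"
    and sup: "(SUP f\<in>Fclass d R \<mu> \<beta>. ereal (f (final_point T Q Qout f) - f (minimizer d f))) \<le> ereal \<epsilon>"
    by blast
  show "enat N \<le> enat T"
  proof (rule ccontr)
    assume "\<not> enat N \<le> enat T"
    then have TN: "T < N" by simp
    \<comment> \<open>The output is appended as a query, repeated for ever.\<close>
    define X where "X F t = (if t < T then Q t (run Q F t) else final_point T Q Qout F)" for F t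
    have "X F t = X F' t" if eq: "\<And>u. u < t \<Longrightarrow> F (X F u) = F' (X F u)" for F F' t
    proof (cases "t < T")
      case True
      have "run Q F t = run Q F' t"
        using eq True by (intro run_cong) (simp add: X_def)
      then show ?thesis using True by (simp add: X_def)
    next
      case False
      have "run Q F T = run Q F' T"
      proof (rule run_cong)
        fix u assume "u < T"
        then show "F (Q u (run Q F u)) = F' (Q u (run Q F u))"
          using eq[of u] False by (simp add: X_def)
      qed
      then show ?thesis using False by (simp add: X_def final_point_def)
    qed
    moreover have "nrm d (X F t) \<le> R" for F t
    proof -
      have "X F t \<in> space (Xspace d R)"
      proof (cases "t < T")
        case True
        then have "Q t \<in> Hspace d R t \<rightarrow>\<^sub>M Xspace d R"
          using alg by (simp add: algorithm_def)
        then show ?thesis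
          using measurable_space[OF _ run_in_space[OF alg, of t F]] True by (simp add: X_def)
      next
        case False
        have "Qout \<in> Hspace d R T \<rightarrow>\<^sub>M Xspace d R"
          using alg by (simp add: algorithm_def)
        then show ?thesis
          using measurable_space[OF _ run_in_space[OF alg order_refl, of F]] False
          by (simp add: X_def final_point_def)
      qed
      then show ?thesis by (simp add: space_Xspace B2_def)
    qed
    ultimately obtain F where F: "F \<in> Fclass d R \<mu> \<beta>" "\<epsilon> < F (X F (N - 1)) - F (minimizer d F)"
      using hard[of X] by blast
    have "ereal (F (final_point T Q Qout F) - F (minimizer d F)) \<le> ereal \<epsilon>"
      using SUP_upper[OF F(1)] sup by (rule order_trans)
    moreover have "X F (N - 1) = final_point T Q Qout F"
      using TN unfolding X_def by auto
    ultimately show False using F(2) by simp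
  qed
qed

lemma Ncomp_lower_bound:
  fixes d :: nat
  assumes d: "4 \<le> d" and "0 < R" "0 < \<mu>" "\<mu> \<le> \<beta>" "0 < \<epsilon>" "\<epsilon> \<le> 1 / 16 * \<beta> * R\<^sup>2"
  defines "M \<equiv> min (sqrt (\<beta> * R\<^sup>2 / \<epsilon>))
      (min (sqrt (\<beta> / \<mu>)) ((real d / ln (exp 1 * real d)) powr (1 / 3)))"
  shows "\<exists>N. 1 / 1600 * real d * M \<le> real N \<and> enat N \<le> Ncomp \<epsilon> d R \<mu> \<beta>"
\<comment> \<open>Below the threshold at most \<open>d / 16\<close> queries are claimed and the
  sphere objective suffices; above it \<open>k\<close> is positive.\<close>
proof (cases "M < 100")
  case True
  have "enat (d - 1) \<le> Ncomp \<epsilon> d R \<mu> \<beta>"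
  proof (rule Ncomp_ge)
    fix X :: "((nat \<Rightarrow> real) \<Rightarrow> real) \<Rightarrow> nat \<Rightarrow> nat \<Rightarrow> real"
    assume causal: "\<And>F F' t. (\<And>u. u < t \<Longrightarrow> F (X F u) = F' (X F u)) \<Longrightarrow> X F t = X F' t"
    have "\<exists>F\<in>Fclass d R \<mu> \<beta>. \<beta> * R\<^sup>2 / 8 \<le> F (X F (d - 1 - 1)) - F (minimizer d F)"
      by (rule sphere_objective[OF causal]) (use assms in auto)
    moreover have "\<epsilon> < \<beta> * R\<^sup>2 / 8"
      using assms by (intro le_less_trans[OF assms(6)]) simp
    ultimately show "\<exists>F\<in>Fclass d R \<mu> \<beta>. \<epsilon> < F (X F (d - 1 - 1)) - F (minimizer d F)"
      by force
  qed
  moreover have "1 / 1600 * real d * M \<le> real (d - 1)"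
  proof -
    have "1 / 1600 * real d * M \<le> 1 / 1600 * real d * 100"
      using True by (intro mult_left_mono) auto
    also have "\<dots> \<le> real (d - 1)"
      using d by (simp add: of_nat_diff)
    finally show ?thesis .
  qed
  ultimately show ?thesis by blast
next
  case False
  \<comment> \<open>The square of 100 exceeds 9 and 2304, and its cube leaves room for the condition
    \<open>large\<close>. Rounding down loses at most a factor 2.\<close>
  define k where "k = nat \<lfloor>M / 100\<rfloor>"
  define \<Lambda> where "\<Lambda> = ln (exp 1 * real d)"
  have \<Lambda>: "\<Lambda> = 1 + ln (real d)" "1 \<le> \<Lambda>"
    using d by (auto simp: \<Lambda>_def ln_mult)
  have k: "0 < k" "real k \<le> M / 100" "M / 200 \<le> real k"
  proof -
    have fl: "1 \<le> \<lfloor>M / 100\<rfloor>" using False by simp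
    then have rk: "real k = of_int \<lfloor>M / 100\<rfloor>" by (simp add: k_def)
    show "0 < k" using fl by (simp add: k_def)
    show "real k \<le> M / 100" unfolding rk by (rule of_int_floor_le)
    have "M / 100 < real k + 1" "1 \<le> real k" unfolding rk using fl by linarith+
    then show "M / 200 \<le> real k" by linarith
  qed
  have "M \<le> sqrt (\<beta> * R\<^sup>2 / \<epsilon>)" "M \<le> sqrt (\<beta> / \<mu>)" "M \<le> (real d / \<Lambda>) powr (1 / 3)"
    unfolding M_def \<Lambda>_def by (simp_all add: min_le_iff_disj)
  then have "real k \<le> sqrt (\<beta> * R\<^sup>2 / \<epsilon>) / 100" "real k \<le> sqrt (\<beta> / \<mu>) / 100"
    "real k \<le> (real d / \<Lambda>) powr (1 / 3) / 100"
    using k(2) by linarith+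
  then have "(real k)\<^sup>2 \<le> (sqrt (\<beta> * R\<^sup>2 / \<epsilon>) / 100)\<^sup>2" "(real k)\<^sup>2 \<le> (sqrt (\<beta> / \<mu>) / 100)\<^sup>2"
    and k3: "real k ^ 3 \<le> ((real d / \<Lambda>) powr (1 / 3) / 100) ^ 3"
    by (auto intro: power_mono)
  then have kQ: "(real k)\<^sup>2 \<le> \<beta> * R\<^sup>2 / \<epsilon> / 10000" and k\<kappa>: "(real k)\<^sup>2 \<le> \<beta> / \<mu> / 10000"
    using assms by (auto simp: power_divide)
  have "((real d / \<Lambda>) powr (1 / 3)) ^ 3 = real d / \<Lambda>"
    using d \<Lambda>(2) by (simp add: powr_powr flip: powr_numeral)
  then have "real k ^ 3 \<le> real d / \<Lambda> / 1000000"
    using k3 by (simp add: power_divide)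
  then have k\<Lambda>: "1000000 * (real k ^ 3 * \<Lambda>) \<le> real d"
    using \<Lambda>(2) by (simp add: field_simps)
  have "real k \<le> real k ^ 3"
    using k(1) self_le_power[of "real k" 3] by simp
  also have "\<dots> \<le> real k ^ 3 * \<Lambda>"
    using mult_left_mono[OF \<Lambda>(2), of "real k ^ 3"] by simp
  finally have kd: "1000000 * real k \<le> real d" using k\<Lambda> by simp
  \<comment> \<open>Since \<open>k\<close> is tiny compared with \<open>d\<close>, at least
    \<open>d / 2\<close> dimensions remain for near-orthogonality.\<close>
  define p where "p = d div 4"
  define m where "m = d - k - p"
  have p: "0 < p" "4 * p \<le> d" "d \<le> 8 * p"
    unfolding p_def using d by presburger+
  have m: "0 < m" "k + p + m \<le> d" "real d / 2 \<le> real m"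
    using kd p d by (auto simp: m_def)
  have "enat (k * p) \<le> Ncomp \<epsilon> d R \<mu> \<beta>"
  proof (rule Ncomp_ge)
    fix X :: "((nat \<Rightarrow> real) \<Rightarrow> real) \<Rightarrow> nat \<Rightarrow> nat \<Rightarrow> real"
    assume causal: "\<And>F F' t. (\<And>u. u < t \<Longrightarrow> F (X F u) = F' (X F u)) \<Longrightarrow> X F t = X F' t"
      and ball: "\<And>F t. nrm d (X F t) \<le> R"
    \<comment> \<open>The logarithm is at most \<open>2 * \<Lambda>\<close>, so the cube-root term
      of \<open>M\<close> yields \<open>large\<close>.\<close>
    have "2 * real (k * p) = (2 * real k) * real p" by simp
    also have "\<dots> \<le> real d * real d"
      using kd p by (intro mult_mono) auto
    finally have "ln (2 * real (k * p)) \<le> ln (real d * real d)"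
      using k p d by (subst ln_le_cancel_iff) auto
    also have "\<dots> \<le> 2 * \<Lambda>"
      using d by (simp add: \<Lambda>(1) ln_mult)
    finally have "8192 * real k ^ 3 * ln (2 * real (k * p)) \<le> 8192 * real k ^ 3 * (2 * \<Lambda>)"
      by (intro mult_left_mono) auto
    also have "\<dots> \<le> real m" using k\<Lambda> m(3) by simp
    finally have large: "8192 * real k ^ 3 * ln (2 * real (k * p)) \<le> real m" .
    have "\<mu> \<le> \<beta> / (9 * (real k)\<^sup>2)"
      using k\<kappa> k(1) assms by (simp add: field_simps)
    from hard_objective[where X = X, OF causal ball \<open>0 < k\<close> \<open>0 < R\<close> \<open>0 < m\<close> \<open>0 < p\<close> _ m(2) large this]
    have "\<exists>F\<in>Fclass d R \<mu> \<beta>.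
        \<beta> * R\<^sup>2 / (2304 * (real k)\<^sup>2) \<le> F (X F (k * p - 1)) - F (minimizer d F)"
      using assms by simp
    moreover have "\<epsilon> < \<beta> * R\<^sup>2 / (2304 * (real k)\<^sup>2)"
    proof -
      have "\<epsilon> * (10000 * (real k)\<^sup>2) \<le> \<beta> * R\<^sup>2"
        using kQ assms by (simp add: field_simps)
      moreover have "\<epsilon> * (2304 * (real k)\<^sup>2) < \<epsilon> * (10000 * (real k)\<^sup>2)"
        using k(1) assms by simp
      ultimately show ?thesis using k(1) by (simp add: less_divide_eq)
    qed
    ultimately show "\<exists>F\<in>Fclass d R \<mu> \<beta>. \<epsilon> < F (X F (k * p - 1)) - F (minimizer d F)"
      by force
  qed
  \<comment> \<open>The constant is the product of the losses \<open>1 / 200\<close> in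
    \<open>k\<close> and \<open>1 / 8\<close> in \<open>p\<close>.\<close>
  moreover have "1 / 1600 * real d * M \<le> real (k * p)"
  proof -
    have "real d \<le> 8 * real p" using p(3) by (metis of_nat_le_iff of_nat_mult of_nat_numeral)
    then have "M / 200 * (real d / 8) \<le> real k * real p"
      using k(3) False by (intro mult_mono) auto
    then show ?thesis by (simp add: mult.commute)
  qed
  ultimately show ?thesis by blast
qed

theorem theorem3p6:
  "\<exists>(c::real) (c\<^sub>\<epsilon>::real) (d\<^sub>0::nat). c > 0 \<and> c\<^sub>\<epsilon> > 0 \<and>
     (\<forall>(d::nat) (R::real) (\<mu>::real) (\<beta>::real) (\<epsilon>::real).
        d \<ge> d\<^sub>0 \<and> R > 0 \<and> 0 < \<mu> \<and> \<mu> \<le> \<beta> \<and> 0 < \<epsilon> \<and> \<epsilon> \<le> c\<^sub>\<epsilon> * \<beta> * R\<^sup>2 \<longrightarrow>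
        ereal_of_enat (Ncomp \<epsilon> d R \<mu> \<beta>) \<ge>
          ereal (c * real d *
            min (sqrt (\<beta> * R\<^sup>2 / \<epsilon>))
              (min (sqrt (\<beta> / \<mu>))
                ((real d / ln (exp 1 * real d)) powr (1 / 3)))))"
proof (rule exI[of _ "1 / 1600"], rule exI[of _ "1 / 16"], rule exI[of _ 4], intro conjI allI impI)
  fix d :: nat and R \<mu> \<beta> \<epsilon> :: real
  assume "4 \<le> d \<and> 0 < R \<and> 0 < \<mu> \<and> \<mu> \<le> \<beta> \<and> 0 < \<epsilon> \<and> \<epsilon> \<le> 1 / 16 * \<beta> * R\<^sup>2"
  with Ncomp_lower_bound[of d R \<mu> \<beta> \<epsilon>]
  obtain N where N: "1 / 1600 * real d * min (sqrt (\<beta> * R\<^sup>2 / \<epsilon>))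
      (min (sqrt (\<beta> / \<mu>)) ((real d / ln (exp 1 * real d)) powr (1 / 3))) \<le> real N"
    "enat N \<le> Ncomp \<epsilon> d R \<mu> \<beta>"
    by blast
  have "ereal (real N) = ereal_of_enat (enat N)" by simp
  also have "\<dots> \<le> ereal_of_enat (Ncomp \<epsilon> d R \<mu> \<beta>)"
    using N(2) by (simp only: ereal_of_enat_le_iff)
  finally show "ereal (1 / 1600 * real d * min (sqrt (\<beta> * R\<^sup>2 / \<epsilon>))
      (min (sqrt (\<beta> / \<mu>)) ((real d / ln (exp 1 * real d)) powr (1 / 3))))
      \<le> ereal_of_enat (Ncomp \<epsilon> d R \<mu> \<beta>)"
    using N(1) by (meson ereal_less_eq(3) order_trans)
qed simp_all

end
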